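(* Let $(L,[-,-],\delta)$ be a Leibniz bialgebra and $(B,\varpi)$ a quadratic anti-commutative anti-associative algebra. Let $A=L\otimes B$ with product $(x_1\otimes b_1)\circ(x_2\otimes b_2)=[x_1,x_2]\otimes(b_1b_2)$, let $\Delta_{\varpi}:B\to B\otimes B$ be the dual of the multiplication of $B$ under $\varpi$, i.e. $\varpi(\Delta_{\varpi}(b_1),b_2\otimes b_3)=\varpi(b_1,b_2b_3)$ for all $b_1,b_2,b_3\in B$, and let $\tilde{\Delta}:A\to A\otimes A$ be the linear map $$\tilde{\Delta}(x\otimes b)=\delta(x)\bullet\Delta_{\varpi}(b)=\sum_{(x)}\sum_{(b)}(x_{(1)}\otimes b_{(1)})\otimes(x_{(2)}\otimes b_{(2)}),$$ where $\delta(x)=\sum_{(x)}x_{(1)}\otimes x_{(2)}$ and $\Delta_\varpi(b)=\sum_{(b)}b_{(1)}\otimes b_{(2)}$. Then $(A,\circ,\tilde{\Delta})$ is an anti-Leibniz bialgebra.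
   Context: $\Bbbk$ is a field of characteristic zero; all vector spaces and algebras are finite-dimensional over $\Bbbk$. $\tau(a\otimes b)=b\otimes a$. For any algebra $X$, $\mathbf{l}_X(x)(y)$ is the product of $x$ and $y$ in this order, and $\mathbf{r}_X(x)(y)$ the product of $y$ and $x$ in this order. (Left) Leibniz algebra: $[x_1,[x_2,x_3]]=[[x_1,x_2],x_3]+[x_2,[x_1,x_3]]$. Leibniz coalgebra $(L,\delta)$: $\delta:L\to L\otimes L$ linear with $(\delta\otimes\mathrm{id})\delta+(\tau\otimes\mathrm{id})(\mathrm{id}\otimes\delta)\delta-(\mathrm{id}\otimes\delta)\delta=0$. Leibniz bialgebra: $(L,[-,-],\delta)$ with $(L,[-,-])$ a Leibniz algebra, $(L,\delta)$ a Leibniz coalgebra and, for all $x,y\in L$, $\tau(\mathbf{r}_L(y)\otimes\mathrm{id})\delta(x)=(\mathbf{r}_L(x)\otimes\mathrm{id})\delta(y)$, $\delta([x,y])=\big(\mathrm{id}\otimes\mathbf{r}_L(y)-(\mathbf{l}_L+\mathbf{r}_L)(y)\otimes\mathrm{id}\big)(\mathrm{id}\otimes\mathrm{id}+\tau)\delta(x)+(\mathrm{id}\otimes\mathbf{l}_L(x)+\mathbf{l}_L(x)\otimes\mathrm{id})\delta(y)$. Anti-commutative anti-associative algebra $(B,\cdot)$: $b_1b_2=-b_2b_1$ and $b_1(b_2b_3)=-(b_1b_2)b_3$. It is quadratic, written $(B,\varpi)$, if equipped with a nondegenerate symmetric bilinear form $\varpi$ that is invariant: $\varpi(b_1b_2,b_3)=\varpi(b_1,b_2b_3)$.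 On $B\otimes B$, $\varpi(b_1\otimes b_2,b_1'\otimes b_2')=\varpi(b_1,b_1')\varpi(b_2,b_2')$. Anti-Leibniz algebra $(A,\cdot)$: $a_1(a_2a_3)+(a_1a_2)a_3+a_2(a_1a_3)=0$. Anti-Leibniz bialgebra: a triple $(A,\cdot,\Delta)$ with $(A,\cdot)$ an anti-Leibniz algebra, $\Delta:A\to A\otimes A$ linear with $(\Delta\otimes\mathrm{id})\Delta+(\mathrm{id}\otimes\Delta)\Delta+(\tau\otimes\mathrm{id})(\mathrm{id}\otimes\Delta)\Delta=0$, and for all $a_1,a_2\in A$: $\Delta(a_1a_2)+\big((\mathrm{id}\otimes\mathbf{r}_A(a_2)-\mathbf{r}_A(a_2)\otimes\mathrm{id}+\mathbf{l}_A(a_2)\otimes\mathrm{id})(\mathrm{id}\otimes\mathrm{id}-\tau)\big)\Delta(a_1)+(\mathrm{id}\otimes\mathbf{l}_A(a_1)+\mathbf{l}_A(a_1)\otimes\mathrm{id})\Delta(a_2)=0$, $(\mathbf{r}_A(a_1)\otimes\mathrm{id})\Delta(a_2)-\tau\big((\mathbf{r}_A(a_2)\otimes\mathrm{id})\Delta(a_1)\big)=0$. *)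

theory Defs
  imports Complex_Main "HOL-Library.Function_Algebras"
begin

section \<open>Vector spaces on carriers\<close>

text \<open>
  A vector space is a subspace (the carrier) of an ambient type on which the scalar
  multiplication satisfies the laws of \<^locale>\<open>vector_space\<close>.  Carriers are needed because a
  tensor product depends on the two scalar multiplications and therefore cannot be a type of its
  own.  The values of the maps below outside the carriers are irrelevant.
\<close>

record ('k, 'v) vspace =
  vcarrier :: "'v set"
  vscale :: "'k \<Rightarrow> 'v \<Rightarrow> 'v"

definition is_vspace :: "('k::field, 'v::ab_group_add) vspace \<Rightarrow> bool" where
  "is_vspace V \<longleftrightarrow> vector_space (vscale V) \<and> module.subspace (vscale V) (vcarrier V)"

definition fd_vspace :: "('k::field, 'v::ab_group_add) vspace \<Rightarrow> bool" where
  "fd_vspace V \<longleftrightarrow> vector_space (vscale V) \<and>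
     (\<exists>S. finite S \<and> vcarrier V = module.span (vscale V) S)"

definition base_field :: "('k::field, 'k) vspace" where
  "base_field = \<lparr>vcarrier = UNIV, vscale = (*)\<rparr>"

definition linear_on ::
  "('k::field, 'v::ab_group_add) vspace \<Rightarrow> ('k, 'w::ab_group_add) vspace \<Rightarrow> ('v \<Rightarrow> 'w) \<Rightarrow> bool"
  where
  "linear_on V W f \<longleftrightarrow>
     (\<forall>x\<in>vcarrier V. f x \<in> vcarrier W) \<and>
     (\<forall>x\<in>vcarrier V. \<forall>y\<in>vcarrier V. f (x + y) = f x + f y) \<and>
     (\<forall>c. \<forall>x\<in>vcarrier V. f (vscale V c x) = vscale W c (f x))"

definition bilinear_on ::
  "('k::field, 'v::ab_group_add) vspace \<Rightarrow> ('k, 'w::ab_group_add) vspace \<Rightarrow>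
   ('k, 'u::ab_group_add) vspace \<Rightarrow> ('v \<Rightarrow> 'w \<Rightarrow> 'u) \<Rightarrow> bool" where
  "bilinear_on V W U f \<longleftrightarrow>
     (\<forall>x\<in>vcarrier V. linear_on W U (f x)) \<and> (\<forall>y\<in>vcarrier W. linear_on V U (\<lambda>x. f x y))"

abbreviation bilinear_form ::
  "('k::field, 'v::ab_group_add) vspace \<Rightarrow> ('k, 'w::ab_group_add) vspace \<Rightarrow> ('v \<Rightarrow> 'w \<Rightarrow> 'k) \<Rightarrow> bool"
  where "bilinear_form V W \<equiv> bilinear_on V W base_field"


section \<open>Tensor products\<close>

text \<open>
  The pure tensor of \<open>v\<close> and \<open>w\<close> is the evaluation functional \<open>h \<mapsto> h v w\<close> on the space of
  bilinear forms (extended by 0 to all functions), and the tensor product is the span of the pure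
  tensors inside the dual of the space of bilinear forms.  The universal property is
  \<open>tensor_universal\<close> and \<open>tensor_universal_unique\<close> below.
\<close>

definition pure_tensor ::
  "('k::field, 'v::ab_group_add) vspace \<Rightarrow> ('k, 'w::ab_group_add) vspace \<Rightarrow>
   'v \<Rightarrow> 'w \<Rightarrow> (('v \<Rightarrow> 'w \<Rightarrow> 'k) \<Rightarrow> 'k)" where
  "pure_tensor V W v w = (\<lambda>h. if bilinear_form V W h then h v w else 0)"

definition fun_scale :: "'k::field \<Rightarrow> ('i \<Rightarrow> 'k) \<Rightarrow> ('i \<Rightarrow> 'k)" where
  "fun_scale c t = (\<lambda>h. c * t h)"

definition tensor ::
  "('k::field, 'v::ab_group_add) vspace \<Rightarrow> ('k, 'w::ab_group_add) vspace \<Rightarrow>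
   ('k, ('v \<Rightarrow> 'w \<Rightarrow> 'k) \<Rightarrow> 'k) vspace" (infixl "\<otimes>" 75) where
  "V \<otimes> W =
     \<lparr>vcarrier = module.span fun_scale
        {pure_tensor V W v w | v w. v \<in> vcarrier V \<and> w \<in> vcarrier W},
      vscale = fun_scale\<rparr>"

text \<open>The linear map on \<open>V \<otimes> W\<close> induced by a bilinear map \<open>f\<close>.\<close>

definition tlift ::
  "('k::field, 'v::ab_group_add) vspace \<Rightarrow> ('k, 'w::ab_group_add) vspace \<Rightarrow>
   ('k, 'u::ab_group_add) vspace \<Rightarrow> ('v \<Rightarrow> 'w \<Rightarrow> 'u) \<Rightarrow> (('v \<Rightarrow> 'w \<Rightarrow> 'k) \<Rightarrow> 'k) \<Rightarrow> 'u" where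
  "tlift V W U f = (SOME g. linear_on (V \<otimes> W) U g \<and>
     (\<forall>v\<in>vcarrier V. \<forall>w\<in>vcarrier W. g (pure_tensor V W v w) = f v w))"

text \<open>\<open>f \<otimes> g\<close> for \<open>f : V \<rightarrow> V'\<close> and \<open>g : W \<rightarrow> W'\<close>.\<close>

definition tmap ::
  "('k::field, 'v::ab_group_add) vspace \<Rightarrow> ('k, 'w::ab_group_add) vspace \<Rightarrow>
   ('k, 'v2::ab_group_add) vspace \<Rightarrow> ('k, 'w2::ab_group_add) vspace \<Rightarrow>
   ('v \<Rightarrow> 'v2) \<Rightarrow> ('w \<Rightarrow> 'w2) \<Rightarrow>
   (('v \<Rightarrow> 'w \<Rightarrow> 'k) \<Rightarrow> 'k) \<Rightarrow> (('v2 \<Rightarrow> 'w2 \<Rightarrow> 'k) \<Rightarrow> 'k)" where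
  "tmap V W V' W' f g = tlift V W (V' \<otimes> W') (\<lambda>v w. pure_tensor V' W' (f v) (g w))"

abbreviation tendo where "tendo V f g \<equiv> tmap V V V V f g"

definition tswap ::
  "('k::field, 'v::ab_group_add) vspace \<Rightarrow> ('k, 'w::ab_group_add) vspace \<Rightarrow>
   (('v \<Rightarrow> 'w \<Rightarrow> 'k) \<Rightarrow> 'k) \<Rightarrow> (('w \<Rightarrow> 'v \<Rightarrow> 'k) \<Rightarrow> 'k)" where
  "tswap V W = tlift V W (W \<otimes> V) (\<lambda>v w. pure_tensor W V w v)"

text \<open>The canonical identification of \<open>V \<otimes> (W \<otimes> U)\<close> with \<open>(V \<otimes> W) \<otimes> U\<close>, which is implicit
  on paper.\<close>

definition tassoc ::
  "('k::field, 'v::ab_group_add) vspace \<Rightarrow> ('k, 'w::ab_group_add) vspace \<Rightarrow>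
   ('k, 'u::ab_group_add) vspace \<Rightarrow>
   (('v \<Rightarrow> (('w \<Rightarrow> 'u \<Rightarrow> 'k) \<Rightarrow> 'k) \<Rightarrow> 'k) \<Rightarrow> 'k) \<Rightarrow>
   (((('v \<Rightarrow> 'w \<Rightarrow> 'k) \<Rightarrow> 'k) \<Rightarrow> 'u \<Rightarrow> 'k) \<Rightarrow> 'k)" where
  "tassoc V W U = tlift V (W \<otimes> U) ((V \<otimes> W) \<otimes> U)
     (\<lambda>v. tlift W U ((V \<otimes> W) \<otimes> U) (\<lambda>w u. pure_tensor (V \<otimes> W) U (pure_tensor V W v w) u))"

text \<open>The value \<open>\<omega>(p, q)\<close> for \<open>p, q\<close> in \<open>V \<otimes> V\<close>, determined by
  \<open>\<omega>(v\<^sub>1 \<otimes> v\<^sub>2, w\<^sub>1 \<otimes> w\<^sub>2) = \<omega>(v\<^sub>1, w\<^sub>1) \<omega>(v\<^sub>2, w\<^sub>2)\<close>.\<close>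

definition tensor_form ::
  "('k::field, 'v::ab_group_add) vspace \<Rightarrow> ('v \<Rightarrow> 'v \<Rightarrow> 'k) \<Rightarrow>
   (('v \<Rightarrow> 'v \<Rightarrow> 'k) \<Rightarrow> 'k) \<Rightarrow> (('v \<Rightarrow> 'v \<Rightarrow> 'k) \<Rightarrow> 'k) \<Rightarrow> 'k" where
  "tensor_form V \<omega> p q =
     tlift V V base_field (\<lambda>v1 v2. tlift V V base_field (\<lambda>w1 w2. \<omega> v1 w1 * \<omega> v2 w2) q) p"

text \<open>The element \<open>p \<bullet> q\<close> of \<open>(V \<otimes> W) \<otimes> (V \<otimes> W)\<close> for \<open>p\<close> in \<open>V \<otimes> V\<close> and \<open>q\<close> in \<open>W \<otimes> W\<close>, determined
  by \<open>(v\<^sub>1 \<otimes> v\<^sub>2) \<bullet> (w\<^sub>1 \<otimes> w\<^sub>2) = (v\<^sub>1 \<otimes> w\<^sub>1) \<otimes> (v\<^sub>2 \<otimes> w\<^sub>2)\<close>.\<close>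

definition bullet ::
  "('k::field, 'v::ab_group_add) vspace \<Rightarrow> ('k, 'w::ab_group_add) vspace \<Rightarrow>
   (('v \<Rightarrow> 'v \<Rightarrow> 'k) \<Rightarrow> 'k) \<Rightarrow> (('w \<Rightarrow> 'w \<Rightarrow> 'k) \<Rightarrow> 'k) \<Rightarrow>
   (((('v \<Rightarrow> 'w \<Rightarrow> 'k) \<Rightarrow> 'k) \<Rightarrow> (('v \<Rightarrow> 'w \<Rightarrow> 'k) \<Rightarrow> 'k) \<Rightarrow> 'k) \<Rightarrow> 'k)" where
  "bullet V W p q =
     tlift V V ((V \<otimes> W) \<otimes> (V \<otimes> W)) (\<lambda>v1 v2.
       tlift W W ((V \<otimes> W) \<otimes> (V \<otimes> W)) (\<lambda>w1 w2.
         pure_tensor (V \<otimes> W) (V \<otimes> W) (pure_tensor V W v1 w1) (pure_tensor V W v2 w2)) q) p"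

subsection \<open>The universal property\<close>

lemma vector_space_fun_scale: "vector_space fun_scale"
  by unfold_locales (auto simp: fun_scale_def fun_eq_iff algebra_simps)

lemma vector_space_mult: "vector_space ((*) :: 'k::field \<Rightarrow> 'k \<Rightarrow> 'k)"
  by unfold_locales (auto simp: algebra_simps)

lemma vcarrier_base_field [simp]: "vcarrier base_field = UNIV"
  and vscale_base_field [simp]: "vscale base_field = (*)"
  by (simp_all add: base_field_def)

lemma vscale_tensor [simp]: "vscale (V \<otimes> W) = fun_scale"
  by (simp add: tensor_def)

lemma fd_vspace_imp_is_vspace:
  assumes "fd_vspace V" shows "is_vspace V"
proof -
  obtain S where vs: "vector_space (vscale V)" and S: "vcarrier V = module.span (vscale V) S"
    using assms by (auto simp: fd_vspace_def)
  interpret vector_space "vscale V" by (rule vs)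
  show ?thesis using vs by (simp add: is_vspace_def S)
qed

lemma is_vspace_base_field: "is_vspace base_field"
proof -
  interpret vector_space "(*)" by (rule vector_space_mult)
  show ?thesis using vector_space_mult by (simp add: is_vspace_def)
qed

lemma is_vspace_tensor: "is_vspace (V \<otimes> W)"
proof -
  interpret vector_space fun_scale by (rule vector_space_fun_scale)
  show ?thesis using vector_space_fun_scale by (simp add: is_vspace_def tensor_def)
qed

lemma is_vspaceD:
  assumes "is_vspace V"
  shows "0 \<in> vcarrier V"
    and "x \<in> vcarrier V \<Longrightarrow> y \<in> vcarrier V \<Longrightarrow> x + y \<in> vcarrier V"
    and "x \<in> vcarrier V \<Longrightarrow> vscale V c x \<in> vcarrier V"
proof -
  have vs: "vector_space (vscale V)" and S: "module.subspace (vscale V) (vcarrier V)"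
    using assms by (auto simp: is_vspace_def)
  interpret vector_space "vscale V" by (rule vs)
  show "0 \<in> vcarrier V"
    and "x \<in> vcarrier V \<Longrightarrow> y \<in> vcarrier V \<Longrightarrow> x + y \<in> vcarrier V"
    and "x \<in> vcarrier V \<Longrightarrow> vscale V c x \<in> vcarrier V"
    using S by (auto simp: subspace_def)
qed

lemma pure_tensor_in_tensor:
  assumes "v \<in> vcarrier V" "w \<in> vcarrier W"
  shows "pure_tensor V W v w \<in> vcarrier (V \<otimes> W)"
proof -
  interpret vector_space fun_scale by (rule vector_space_fun_scale)
  have "pure_tensor V W v w \<in> {pure_tensor V W v w | v w. v \<in> vcarrier V \<and> w \<in> vcarrier W}"
    using assms by blast
  then show ?thesis by (simp add: tensor_def span_base)
qed

lemma tensor_induct [consumes 1, case_names zero step]: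
  assumes "t \<in> vcarrier (V \<otimes> W)"
    and "P 0"
    and "\<And>c v w t. v \<in> vcarrier V \<Longrightarrow> w \<in> vcarrier W \<Longrightarrow> t \<in> vcarrier (V \<otimes> W) \<Longrightarrow> P t \<Longrightarrow>
      P (fun_scale c (pure_tensor V W v w) + t)"
  shows "P t"
proof -
  interpret vector_space fun_scale by (rule vector_space_fun_scale)
  let ?S = "{pure_tensor V W v w | v w. v \<in> vcarrier V \<and> w \<in> vcarrier W}"
  have "t \<in> module.span fun_scale ?S"
    using assms(1) by (simp add: tensor_def)
  then have "t \<in> vcarrier (V \<otimes> W) \<and> P t"
  proof (induction rule: span_induct_alt)
    case base
    then show ?case
      using assms(2) is_vspaceD(1)[OF is_vspace_tensor] by blast
  next
    case (step c x y)
    then obtain v w where vw: "x = pure_tensor V W v w" "v \<in> vcarrier V" "w \<in> vcarrier W"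
      by blast
    have "fun_scale c x \<in> vcarrier (V \<otimes> W)"
      using is_vspaceD(3)[OF is_vspace_tensor, of x V W c] pure_tensor_in_tensor[OF vw(2,3)] vw(1)
      by simp
    then have "fun_scale c x + y \<in> vcarrier (V \<otimes> W)"
      using step is_vspaceD(2)[OF is_vspace_tensor] by blast
    then show ?case
      using assms(3)[OF vw(2,3), of y c] step(2) vw(1) by (simp only: simp_thms)
  qed
  then show ?thesis by blast
qed

lemma bilinear_on_pure_tensor:
  assumes "is_vspace V" "is_vspace W"
  shows "bilinear_on V W (V \<otimes> W) (pure_tensor V W)"
  unfolding bilinear_on_def linear_on_def
  by (auto simp: pure_tensor_in_tensor)
    (auto simp: pure_tensor_def fun_scale_def fun_eq_iff bilinear_on_def linear_on_def)

lemma functionals_separate: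
  fixes s :: "'k::field \<Rightarrow> 'u::ab_group_add \<Rightarrow> 'u"
  assumes s: "vector_space s"
    and eq: "\<And>\<phi>. Vector_Spaces.linear s (*) \<phi> \<Longrightarrow> \<phi> x = \<phi> y"
  shows "x = y"
proof (rule ccontr)
  assume "x \<noteq> y"
  interpret s: vector_space s by fact
  interpret k: vector_space "(*) :: 'k \<Rightarrow> 'k \<Rightarrow> 'k" by (rule vector_space_mult)
  interpret p: vector_space_pair s "(*) :: 'k \<Rightarrow> 'k \<Rightarrow> 'k" ..
  have "s.independent {x - y}"
    using \<open>x \<noteq> y\<close> by (subst s.dependent_single) simp
  then obtain \<phi> where \<phi>: "Vector_Spaces.linear s (*) \<phi>" "\<phi> (x - y) = 1"
    using p.linear_independent_extend[of "{x - y}" "\<lambda>_. 1"] by blast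
  then have "\<phi> x - \<phi> y = 1"
    using p.linear_diff by metis
  then show False using eq[OF \<phi>(1)] by simp
qed

theorem tensor_universal:
  fixes f :: "'v::ab_group_add \<Rightarrow> 'w::ab_group_add \<Rightarrow> 'u::ab_group_add"
    and V :: "('k::field, 'v) vspace"
  assumes U: "is_vspace U" and f: "bilinear_on V W U f"
  shows "\<exists>g. linear_on (V \<otimes> W) U g \<and>
    (\<forall>v\<in>vcarrier V. \<forall>w\<in>vcarrier W. g (pure_tensor V W v w) = f v w)"
proof -
  let ?lin = "\<lambda>\<phi>. Vector_Spaces.linear (vscale U) ((*) :: 'k \<Rightarrow> 'k \<Rightarrow> 'k) \<phi>"
  define R where "R t u \<longleftrightarrow> u \<in> vcarrier U \<and> (\<forall>\<phi>. ?lin \<phi> \<longrightarrow> \<phi> u = t (\<lambda>v w. \<phi> (f v w)))"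
    for t u
  have vsU: "vector_space (vscale U)" using U by (simp add: is_vspace_def)
  interpret s: vector_space "vscale U" by (rule vsU)
  interpret k: vector_space "(*) :: 'k \<Rightarrow> 'k \<Rightarrow> 'k" by (rule vector_space_mult)
  interpret p: vector_space_pair "vscale U" "(*) :: 'k \<Rightarrow> 'k \<Rightarrow> 'k" ..
  note U_cl = is_vspaceD[OF U]
  have R_fun: "u = u'" if "R t u" "R t u'" for t u u'
    using that by (intro functionals_separate[OF vsU]) (auto simp: R_def)
  have R_add: "R (t + t') (u + u')" if "R t u" "R t' u'" for t t' u u'
    using that U_cl by (auto simp: R_def p.linear_add)
  have R_scale: "R (fun_scale c t) (vscale U c u)" if "R t u" for c t u
    using that U_cl by (auto simp: R_def fun_scale_def p.linear_scale)
  have R_pure: "R (pure_tensor V W v w) (f v w)" if "v \<in> vcarrier V" "w \<in> vcarrier W" for v w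
  proof -
    have "bilinear_form V W (\<lambda>v w. \<phi> (f v w))" if "?lin \<phi>" for \<phi>
      using f by (auto simp: bilinear_on_def linear_on_def p.linear_add[OF that] p.linear_scale[OF that])
    then show ?thesis
      using f that by (auto simp: R_def pure_tensor_def bilinear_on_def linear_on_def)
  qed
  have R_zero: "R 0 0"
    using U_cl by (auto simp: R_def p.linear_0)
  have R_ex: "\<exists>u. R t u" if "t \<in> vcarrier (V \<otimes> W)" for t
    using that by (induction rule: tensor_induct) (blast intro: R_zero R_add R_scale R_pure)+
  define g where "g t = (THE u. R t u)" for t
  have g_eq: "g t = u" if "R t u" for t u
    unfolding g_def using that R_fun by blast
  have R_g: "R t (g t)" if "t \<in> vcarrier (V \<otimes> W)" for t
    using R_ex[OF that] g_eq by blast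
  have "linear_on (V \<otimes> W) U g"
    unfolding linear_on_def
  proof (intro conjI ballI allI)
    show "g x \<in> vcarrier U" if "x \<in> vcarrier (V \<otimes> W)" for x
      using R_g[OF that] by (simp only: R_def)
    show "g (x + y) = g x + g y" if "x \<in> vcarrier (V \<otimes> W)" "y \<in> vcarrier (V \<otimes> W)" for x y
      using g_eq R_add R_g that by blast
    show "g (vscale (V \<otimes> W) c x) = vscale U c (g x)" if "x \<in> vcarrier (V \<otimes> W)" for c x
      unfolding vscale_tensor using g_eq R_scale R_g that by blast
  qed
  moreover have "\<forall>v\<in>vcarrier V. \<forall>w\<in>vcarrier W. g (pure_tensor V W v w) = f v w"
    using g_eq R_pure by blast
  ultimately show ?thesis by blast
qed

theorem tensor_universal_unique:
  assumes U: "is_vspace U"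
    and g: "linear_on (V \<otimes> W) U g" and g': "linear_on (V \<otimes> W) U g'"
    and eq: "\<And>v w. v \<in> vcarrier V \<Longrightarrow> w \<in> vcarrier W \<Longrightarrow>
      g (pure_tensor V W v w) = g' (pure_tensor V W v w)"
    and t: "t \<in> vcarrier (V \<otimes> W)"
  shows "g t = g' t"
  using t
proof (induction rule: tensor_induct)
  case zero
  have "0 \<in> vcarrier (V \<otimes> W)" by (rule is_vspaceD(1)[OF is_vspace_tensor])
  then have "g (0 + 0) = g 0 + g 0" "g' (0 + 0) = g' 0 + g' 0"
    using g g' unfolding linear_on_def by blast+
  then have "g 0 = 0" "g' 0 = 0" by (metis add_0 add_cancel_left_left)+
  then show ?case by (simp only:)
next
  case (step c v w t)
  then have p: "pure_tensor V W v w \<in> vcarrier (V \<otimes> W)" by (simp add: pure_tensor_in_tensor)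
  then have sp: "fun_scale c (pure_tensor V W v w) \<in> vcarrier (V \<otimes> W)"
    using is_vspaceD(3)[OF is_vspace_tensor, of "pure_tensor V W v w" V W c] by simp
  have "h (fun_scale c (pure_tensor V W v w) + t) = vscale U c (h (pure_tensor V W v w)) + h t"
    if "linear_on (V \<otimes> W) U h" for h
    using that p sp step.hyps by (auto simp: linear_on_def)
  from this[OF g] this[OF g'] show ?case
    using eq[OF step.hyps(1,2)] step.IH by (simp only:)
qed

lemma tlift:
  assumes "is_vspace U" "bilinear_on V W U f"
  shows "linear_on (V \<otimes> W) U (tlift V W U f)"
    and "v \<in> vcarrier V \<Longrightarrow> w \<in> vcarrier W \<Longrightarrow> tlift V W U f (pure_tensor V W v w) = f v w"
  using someI_ex[OF tensor_universal[OF assms]] unfolding tlift_def by blast+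


section \<open>Leibniz bialgebras\<close>

definition lmul :: "('v \<Rightarrow> 'v \<Rightarrow> 'v) \<Rightarrow> 'v \<Rightarrow> 'v \<Rightarrow> 'v" where
  "lmul m x = (\<lambda>y. m x y)"

definition rmul :: "('v \<Rightarrow> 'v \<Rightarrow> 'v) \<Rightarrow> 'v \<Rightarrow> 'v \<Rightarrow> 'v" where
  "rmul m x = (\<lambda>y. m y x)"

definition fd_algebra ::
  "('k::field, 'v::ab_group_add) vspace \<Rightarrow> ('v \<Rightarrow> 'v \<Rightarrow> 'v) \<Rightarrow> bool" where
  "fd_algebra A m \<longleftrightarrow> fd_vspace A \<and> bilinear_on A A A m"

definition leibniz_algebra ::
  "('k::field, 'v::ab_group_add) vspace \<Rightarrow> ('v \<Rightarrow> 'v \<Rightarrow> 'v) \<Rightarrow> bool" where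
  "leibniz_algebra L br \<longleftrightarrow> fd_algebra L br \<and>
     (\<forall>x1\<in>vcarrier L. \<forall>x2\<in>vcarrier L. \<forall>x3\<in>vcarrier L.
        br x1 (br x2 x3) = br (br x1 x2) x3 + br x2 (br x1 x3))"

text \<open>Sums and differences of linear maps, here and below, are pointwise.\<close>

definition leibniz_coalgebra ::
  "('k::field, 'v::ab_group_add) vspace \<Rightarrow> ('v \<Rightarrow> (('v \<Rightarrow> 'v \<Rightarrow> 'k) \<Rightarrow> 'k)) \<Rightarrow> bool" where
  "leibniz_coalgebra L \<delta> \<longleftrightarrow> fd_vspace L \<and> linear_on L (L \<otimes> L) \<delta> \<and>
     (\<forall>x\<in>vcarrier L.
        tmap L L (L \<otimes> L) L \<delta> id (\<delta> x)
        + tmap (L \<otimes> L) L (L \<otimes> L) L (tswap L L) id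
            (tassoc L L L (tmap L L L (L \<otimes> L) id \<delta> (\<delta> x)))
        - tassoc L L L (tmap L L L (L \<otimes> L) id \<delta> (\<delta> x)) = 0)"

definition leibniz_bialgebra ::
  "('k::field, 'v::ab_group_add) vspace \<Rightarrow> ('v \<Rightarrow> 'v \<Rightarrow> 'v) \<Rightarrow>
   ('v \<Rightarrow> (('v \<Rightarrow> 'v \<Rightarrow> 'k) \<Rightarrow> 'k)) \<Rightarrow> bool" where
  "leibniz_bialgebra L br \<delta> \<longleftrightarrow> leibniz_algebra L br \<and> leibniz_coalgebra L \<delta> \<and>
     (\<forall>x\<in>vcarrier L. \<forall>y\<in>vcarrier L.
        tswap L L (tendo L (rmul br y) id (\<delta> x)) = tendo L (rmul br x) id (\<delta> y)) \<and>
     (\<forall>x\<in>vcarrier L. \<forall>y\<in>vcarrier L.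
        \<delta> (br x y) =
          (tendo L id (rmul br y) - tendo L (lmul br y + rmul br y) id) ((id + tswap L L) (\<delta> x))
          + (tendo L id (lmul br x) + tendo L (lmul br x) id) (\<delta> y))"


section \<open>Quadratic anti-commutative anti-associative algebras\<close>

definition acaa_algebra ::
  "('k::field, 'v::ab_group_add) vspace \<Rightarrow> ('v \<Rightarrow> 'v \<Rightarrow> 'v) \<Rightarrow> bool" where
  "acaa_algebra B m \<longleftrightarrow> fd_algebra B m \<and>
     (\<forall>b1\<in>vcarrier B. \<forall>b2\<in>vcarrier B. m b1 b2 = - m b2 b1) \<and>
     (\<forall>b1\<in>vcarrier B. \<forall>b2\<in>vcarrier B. \<forall>b3\<in>vcarrier B. m b1 (m b2 b3) = - m (m b1 b2) b3)"

definition quadratic_acaa_algebra ::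
  "('k::field, 'v::ab_group_add) vspace \<Rightarrow> ('v \<Rightarrow> 'v \<Rightarrow> 'v) \<Rightarrow> ('v \<Rightarrow> 'v \<Rightarrow> 'k) \<Rightarrow> bool" where
  "quadratic_acaa_algebra B m \<omega> \<longleftrightarrow> acaa_algebra B m \<and> bilinear_form B B \<omega> \<and>
     (\<forall>x\<in>vcarrier B. \<forall>y\<in>vcarrier B. \<omega> x y = \<omega> y x) \<and>
     (\<forall>x\<in>vcarrier B. (\<forall>y\<in>vcarrier B. \<omega> x y = 0) \<longrightarrow> x = 0) \<and>
     (\<forall>b1\<in>vcarrier B. \<forall>b2\<in>vcarrier B. \<forall>b3\<in>vcarrier B. \<omega> (m b1 b2) b3 = \<omega> b1 (m b2 b3))"


section \<open>Anti-Leibniz bialgebras\<close>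

definition anti_leibniz_algebra ::
  "('k::field, 'v::ab_group_add) vspace \<Rightarrow> ('v \<Rightarrow> 'v \<Rightarrow> 'v) \<Rightarrow> bool" where
  "anti_leibniz_algebra A m \<longleftrightarrow> fd_algebra A m \<and>
     (\<forall>a1\<in>vcarrier A. \<forall>a2\<in>vcarrier A. \<forall>a3\<in>vcarrier A.
        m a1 (m a2 a3) + m (m a1 a2) a3 + m a2 (m a1 a3) = 0)"

definition anti_leibniz_bialgebra ::
  "('k::field, 'v::ab_group_add) vspace \<Rightarrow> ('v \<Rightarrow> 'v \<Rightarrow> 'v) \<Rightarrow>
   ('v \<Rightarrow> (('v \<Rightarrow> 'v \<Rightarrow> 'k) \<Rightarrow> 'k)) \<Rightarrow> bool" where
  "anti_leibniz_bialgebra A m \<Delta> \<longleftrightarrow> anti_leibniz_algebra A m \<and> linear_on A (A \<otimes> A) \<Delta> \<and>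
     (\<forall>a\<in>vcarrier A.
        tmap A A (A \<otimes> A) A \<Delta> id (\<Delta> a)
        + tassoc A A A (tmap A A A (A \<otimes> A) id \<Delta> (\<Delta> a))
        + tmap (A \<otimes> A) A (A \<otimes> A) A (tswap A A) id
            (tassoc A A A (tmap A A A (A \<otimes> A) id \<Delta> (\<Delta> a))) = 0) \<and>
     (\<forall>a1\<in>vcarrier A. \<forall>a2\<in>vcarrier A.
        \<Delta> (m a1 a2)
        + (tendo A id (rmul m a2) - tendo A (rmul m a2) id + tendo A (lmul m a2) id)
            ((id - tswap A A) (\<Delta> a1))
        + (tendo A id (lmul m a1) + tendo A (lmul m a1) id) (\<Delta> a2) = 0) \<and>
     (\<forall>a1\<in>vcarrier A. \<forall>a2\<in>vcarrier A.
        tendo A (rmul m a1) id (\<Delta> a2) - tswap A A (tendo A (rmul m a2) id (\<Delta> a1)) = 0)"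

end

theory Submission
  imports Defs
begin

text \<open>
  In an anti-commutative anti-associative algebra, \<open>(ab)c\<close> is antisymmetric in all three arguments.
  By invariance and nondegeneracy of \<open>\<omega>\<close>, a tensor in \<open>B \<otimes> B\<close> or \<open>B \<otimes> B \<otimes> B\<close> is determined by its pairings
  under \<open>\<omega>\<close> with pure tensors, and so every tensor built from \<open>\<Delta>\<^sub>\<omega>\<close> and the multiplication that occurs
  in one of the anti-Leibniz bialgebra conditions equals, up to sign, one and the same tensor
  (\<open>\<Delta>\<^sub>\<omega>(bc)\<close>, respectively \<open>(\<Delta>\<^sub>\<omega> \<otimes> id)\<Delta>\<^sub>\<omega>(b)\<close>).  Since \<open>\<bullet>\<close> is bilinear and compatible with \<open>f \<otimes> g\<close>, \<open>\<tau>\<close> and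
  reassociation, each condition for \<open>L \<otimes> B\<close> becomes the corresponding condition for \<open>L\<close>, bulleted with
  this tensor; the signs turn Leibniz into anti-Leibniz.
\<close>


section \<open>Linear and bilinear maps\<close>

lemma linear_onD:
  assumes "linear_on V W f"
  shows "x \<in> vcarrier V \<Longrightarrow> f x \<in> vcarrier W"
    and "x \<in> vcarrier V \<Longrightarrow> y \<in> vcarrier V \<Longrightarrow> f (x + y) = f x + f y"
    and "x \<in> vcarrier V \<Longrightarrow> f (vscale V c x) = vscale W c (f x)"
  using assms by (auto simp: linear_on_def)

lemma linear_onI:
  assumes "\<And>x. x \<in> vcarrier V \<Longrightarrow> f x \<in> vcarrier W"
    and "\<And>x y. x \<in> vcarrier V \<Longrightarrow> y \<in> vcarrier V \<Longrightarrow> f (x + y) = f x + f y"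
    and "\<And>c x. x \<in> vcarrier V \<Longrightarrow> f (vscale V c x) = vscale W c (f x)"
  shows "linear_on V W f"
  using assms by (auto simp: linear_on_def)

lemma bilinear_onD:
  assumes "bilinear_on V W U f"
  shows "x \<in> vcarrier V \<Longrightarrow> linear_on W U (f x)"
    and "y \<in> vcarrier W \<Longrightarrow> linear_on V U (\<lambda>x. f x y)"
    and "x \<in> vcarrier V \<Longrightarrow> y \<in> vcarrier W \<Longrightarrow> f x y \<in> vcarrier U"
  using assms by (auto simp: bilinear_on_def linear_on_def)

lemma bilinear_onI:
  assumes "\<And>x. x \<in> vcarrier V \<Longrightarrow> linear_on W U (\<lambda>y. f x y)"
    and "\<And>y. y \<in> vcarrier W \<Longrightarrow> linear_on V U (\<lambda>x. f x y)"
  shows "bilinear_on V W U f"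
  using assms by (auto simp: bilinear_on_def)

lemma is_vspace_scale:
  assumes "is_vspace V"
  shows "vscale V c (x + y) = vscale V c x + vscale V c y"
    and "vscale V (c + d) x = vscale V c x + vscale V d x"
    and "vscale V c (vscale V d x) = vscale V (c * d) x"
    and "vscale V 1 x = x"
    and "vscale V 0 x = 0"
    and "vscale V c 0 = 0"
    and "vscale V c (- x) = - vscale V c x"
    and "vscale V (- 1) x = - x"
    and "vscale V c (x - y) = vscale V c x - vscale V c y"
proof -
  interpret vector_space "vscale V" using assms by (simp add: is_vspace_def)
  show "vscale V c (x + y) = vscale V c x + vscale V c y"
    and "vscale V (c + d) x = vscale V c x + vscale V d x"
    and "vscale V c (vscale V d x) = vscale V (c * d) x"
    and "vscale V 1 x = x"
    and "vscale V 0 x = 0"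
    and "vscale V c 0 = 0"
    and "vscale V c (- x) = - vscale V c x"
    and "vscale V (- 1) x = - x"
    and "vscale V c (x - y) = vscale V c x - vscale V c y"
    by (simp_all add: scale_right_distrib scale_left_distrib scale_right_diff_distrib)
qed

lemma is_vspace_uminus: "is_vspace V \<Longrightarrow> x \<in> vcarrier V \<Longrightarrow> - x \<in> vcarrier V"
  using is_vspaceD(3)[of V x "- 1"] by (simp add: is_vspace_scale)

lemma is_vspace_diff:
  "is_vspace V \<Longrightarrow> x \<in> vcarrier V \<Longrightarrow> y \<in> vcarrier V \<Longrightarrow> x - y \<in> vcarrier V"
  using is_vspaceD(2)[of V x "- y"] by (simp add: is_vspace_uminus)

lemma is_vspace_sum:
  "is_vspace V \<Longrightarrow> (\<And>i. i \<in> I \<Longrightarrow> f i \<in> vcarrier V) \<Longrightarrow> sum f I \<in> vcarrier V"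
  by (induction I rule: infinite_finite_induct) (auto simp: is_vspaceD)

lemma linear_on_id: "linear_on V V id" "linear_on V V (\<lambda>x. x)"
  by (auto simp: linear_on_def)

lemma linear_on_comp:
  "linear_on W U g \<Longrightarrow> linear_on V W f \<Longrightarrow> linear_on V U (\<lambda>x. g (f x))"
  by (auto simp: linear_on_def)

lemma linear_on_add:
  "is_vspace W \<Longrightarrow> linear_on V W f \<Longrightarrow> linear_on V W g \<Longrightarrow> linear_on V W (\<lambda>x. f x + g x)"
  by (auto simp: linear_on_def is_vspaceD is_vspace_scale)

lemma linear_on_diff:
  "is_vspace W \<Longrightarrow> linear_on V W f \<Longrightarrow> linear_on V W g \<Longrightarrow> linear_on V W (\<lambda>x. f x - g x)"
  by (auto simp: linear_on_def is_vspace_diff is_vspace_scale)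

lemma linear_on_scale:
  "is_vspace W \<Longrightarrow> linear_on V W f \<Longrightarrow> linear_on V W (\<lambda>x. vscale W c (f x))"
  by (auto simp: linear_on_def is_vspaceD is_vspace_scale mult.commute)

lemma linear_on_zero: "is_vspace W \<Longrightarrow> linear_on V W (\<lambda>x. 0)"
  by (auto simp: linear_on_def is_vspaceD is_vspace_scale)

lemma linear_on_sum:
  "is_vspace W \<Longrightarrow> (\<And>i. i \<in> I \<Longrightarrow> linear_on V W (f i)) \<Longrightarrow> linear_on V W (\<lambda>x. \<Sum>i\<in>I. f i x)"
  by (induction I rule: infinite_finite_induct) (auto simp: linear_on_zero linear_on_add)

lemma linear_on_form_scale:
  "is_vspace W \<Longrightarrow> linear_on V base_field \<phi> \<Longrightarrow> w \<in> vcarrier W \<Longrightarrow> linear_on V W (\<lambda>x. vscale W (\<phi> x) w)"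
  by (auto simp: linear_on_def is_vspaceD is_vspace_scale)

lemma linear_on_0:
  assumes "linear_on V W f" "is_vspace V" "is_vspace W"
  shows "f 0 = 0"
  using linear_onD(3)[OF assms(1), of 0 0] assms(2,3) by (simp add: is_vspace_scale is_vspaceD)

lemma linear_on_neg:
  assumes "linear_on V W f" "is_vspace V" "is_vspace W" "x \<in> vcarrier V"
  shows "f (- x) = - f x"
  using linear_onD(3)[OF assms(1,4), of "- 1"] assms(2,3) by (simp add: is_vspace_scale)

lemma linear_on_minus:
  assumes "linear_on V W f" "is_vspace V" "is_vspace W" "x \<in> vcarrier V" "y \<in> vcarrier V"
  shows "f (x - y) = f x - f y"
  using linear_onD(2)[OF assms(1,4), of "- y"] assms
  by (simp add: linear_on_neg is_vspace_uminus)

lemma linear_on_apply_sum: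
  assumes "linear_on V W f" "is_vspace V" "is_vspace W" "\<And>i. i \<in> I \<Longrightarrow> x i \<in> vcarrier V"
  shows "f (\<Sum>i\<in>I. x i) = (\<Sum>i\<in>I. f (x i))"
  using assms(4)
  by (induction I rule: infinite_finite_induct)
    (simp_all add: linear_on_0[OF assms(1-3)] linear_onD(2)[OF assms(1)] is_vspace_sum[OF assms(2)])

lemma bilinear_on_comp:
  assumes "bilinear_on V' W' U h" "linear_on V V' f" "linear_on W W' g"
  shows "bilinear_on V W U (\<lambda>x y. h (f x) (g y))"
proof (rule bilinear_onI)
  show "linear_on W U (\<lambda>y. h (f x) (g y))" if "x \<in> vcarrier V" for x
    using linear_on_comp[OF bilinear_onD(1)[OF assms(1)] assms(3)] linear_onD(1)[OF assms(2) that]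
    by blast
  show "linear_on V U (\<lambda>x. h (f x) (g y))" if "y \<in> vcarrier W" for y
    by (rule linear_on_comp[OF bilinear_onD(2)[OF assms(1)] assms(2)])
      (rule linear_onD(1)[OF assms(3) that])
qed

lemma linear_on_bilinear_on:
  assumes "linear_on U U' k" "bilinear_on V W U h"
  shows "bilinear_on V W U' (\<lambda>x y. k (h x y))"
  using assms
  by (intro bilinear_onI) (rule linear_on_comp[OF assms(1)], erule bilinear_onD[OF assms(2)])+

lemma bilinear_on_add:
  "is_vspace U \<Longrightarrow> bilinear_on V W U f \<Longrightarrow> bilinear_on V W U g \<Longrightarrow>
    bilinear_on V W U (\<lambda>x y. f x y + g x y)"
  by (rule bilinear_onI; rule linear_on_add) (auto dest: bilinear_onD)

lemma bilinear_on_diff: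
  "is_vspace U \<Longrightarrow> bilinear_on V W U f \<Longrightarrow> bilinear_on V W U g \<Longrightarrow>
    bilinear_on V W U (\<lambda>x y. f x y - g x y)"
  by (rule bilinear_onI; rule linear_on_diff) (auto dest: bilinear_onD)

lemma bilinear_on_zero: "is_vspace U \<Longrightarrow> bilinear_on V W U (\<lambda>x y. 0)"
  by (blast intro: bilinear_onI linear_on_zero)

lemma bilinear_on_flip: "bilinear_on V W U f \<Longrightarrow> bilinear_on W V U (\<lambda>y x. f x y)"
  by (auto simp: bilinear_on_def)

lemma bilinear_on_mult_forms:
  assumes "linear_on V base_field \<phi>" "linear_on W base_field \<psi>"
  shows "bilinear_form V W (\<lambda>x y. \<phi> x * \<psi> y)"
  using assms by (auto simp: bilinear_on_def linear_on_def algebra_simps)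


section \<open>Maps out of tensor products\<close>

text \<open>\<open>tlift\<close> is a choice whose predicate sees the bilinear map only on the
  carriers, so maps that agree there lead to literally the same chosen function.\<close>

lemma tlift_cong:
  assumes "\<And>v w. v \<in> vcarrier V \<Longrightarrow> w \<in> vcarrier W \<Longrightarrow> f v w = f' v w"
  shows "tlift V W U f = tlift V W U f'"
  using assms by (simp add: tlift_def cong: conj_cong)

text \<open>For nested lifts such as \<open>tassoc\<close> and \<open>shuffle\<close>: the inner
  lift at a fixed tensor has to depend linearly on the outer variables. For fixed parameters both
  sides of a linearity law are linear in \<open>t\<close>, so uniqueness reduces the law to pure
  tensors.\<close>

lemma linear_on_tlift_param:
  assumes U: "is_vspace U"
    and bil: "\<And>x. x \<in> vcarrier X \<Longrightarrow> bilinear_on V W U (f x)"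
    and lin: "\<And>v w. v \<in> vcarrier V \<Longrightarrow> w \<in> vcarrier W \<Longrightarrow> linear_on X U (\<lambda>x. f x v w)"
    and X: "is_vspace X"
    and t: "t \<in> vcarrier (V \<otimes> W)"
  shows "linear_on X U (\<lambda>x. tlift V W U (f x) t)"
proof (rule linear_onI)
  note lift = tlift[OF U bil]
  show "tlift V W U (f x) t \<in> vcarrier U" if "x \<in> vcarrier X" for x
    using linear_onD(1)[OF lift(1)[OF that] t] .
  show "tlift V W U (f (x + y)) t = tlift V W U (f x) t + tlift V W U (f y) t"
    if "x \<in> vcarrier X" "y \<in> vcarrier X" for x y
  proof (rule tensor_universal_unique[OF U lift(1) linear_on_add[OF U lift(1) lift(1)] _ t])
    show "x + y \<in> vcarrier X" using that X by (simp add: is_vspaceD)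
    then show "tlift V W U (f (x + y)) (pure_tensor V W v w) =
      tlift V W U (f x) (pure_tensor V W v w) + tlift V W U (f y) (pure_tensor V W v w)"
      if "v \<in> vcarrier V" "w \<in> vcarrier W" for v w
      using that \<open>x \<in> _\<close> \<open>y \<in> _\<close> by (simp only: lift(2) linear_onD(2)[OF lin])
  qed fact+
  show "tlift V W U (f (vscale X c x)) t = vscale U c (tlift V W U (f x) t)"
    if "x \<in> vcarrier X" for c x
  proof (rule tensor_universal_unique[OF U lift(1) linear_on_scale[OF U lift(1)] _ t])
    show "vscale X c x \<in> vcarrier X" using that X by (simp add: is_vspaceD)
    then show "tlift V W U (f (vscale X c x)) (pure_tensor V W v w) =
      vscale U c (tlift V W U (f x) (pure_tensor V W v w))"
      if "v \<in> vcarrier V" "w \<in> vcarrier W" for v w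
      using that \<open>x \<in> _\<close> by (simp only: lift(2) linear_onD(3)[OF lin])
  qed fact+
qed

text \<open>Uniqueness is applied in \<open>p\<close> with \<open>q\<close> fixed, and then in
  \<open>q\<close>. Identities between bilinear maps of two tensors can thus be checked on pure
  tensors.\<close>

lemma bilinear_unique:
  assumes U: "is_vspace U"
    and F: "bilinear_on (V1 \<otimes> V2) (W1 \<otimes> W2) U F" and G: "bilinear_on (V1 \<otimes> V2) (W1 \<otimes> W2) U G"
    and eq: "\<And>v1 v2 w1 w2. v1 \<in> vcarrier V1 \<Longrightarrow> v2 \<in> vcarrier V2 \<Longrightarrow>
      w1 \<in> vcarrier W1 \<Longrightarrow> w2 \<in> vcarrier W2 \<Longrightarrow>
      F (pure_tensor V1 V2 v1 v2) (pure_tensor W1 W2 w1 w2) =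
      G (pure_tensor V1 V2 v1 v2) (pure_tensor W1 W2 w1 w2)"
    and p: "p \<in> vcarrier (V1 \<otimes> V2)" and q: "q \<in> vcarrier (W1 \<otimes> W2)"
  shows "F p q = G p q"
proof (rule tensor_universal_unique[OF U bilinear_onD(2)[OF F q] bilinear_onD(2)[OF G q] _ p])
  fix v1 v2 assume v: "v1 \<in> vcarrier V1" "v2 \<in> vcarrier V2"
  note pv = pure_tensor_in_tensor[OF v]
  show "F (pure_tensor V1 V2 v1 v2) q = G (pure_tensor V1 V2 v1 v2) q"
    by (rule tensor_universal_unique[OF U bilinear_onD(1)[OF F pv] bilinear_onD(1)[OF G pv] _ q])
      (rule eq[OF v])
qed

section \<open>Induced maps: \<open>f \<otimes> g\<close>, the flip and reassociation\<close>

lemma tmap: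
  assumes "is_vspace V'" "is_vspace W'" "linear_on V V' f" "linear_on W W' g"
  shows "linear_on (V \<otimes> W) (V' \<otimes> W') (tmap V W V' W' f g)"
    and "v \<in> vcarrier V \<Longrightarrow> w \<in> vcarrier W \<Longrightarrow>
      tmap V W V' W' f g (pure_tensor V W v w) = pure_tensor V' W' (f v) (g w)"
  unfolding tmap_def
  using tlift[OF is_vspace_tensor bilinear_on_comp[OF bilinear_on_pure_tensor[OF assms(1,2)] assms(3,4)]]
  by blast+

lemma tswap:
  assumes "is_vspace V" "is_vspace W"
  shows "linear_on (V \<otimes> W) (W \<otimes> V) (tswap V W)"
    and "v \<in> vcarrier V \<Longrightarrow> w \<in> vcarrier W \<Longrightarrow>
      tswap V W (pure_tensor V W v w) = pure_tensor W V w v"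
  unfolding tswap_def
  using tlift[OF is_vspace_tensor bilinear_on_flip[OF bilinear_on_pure_tensor[OF assms(2,1)]]]
  by blast+

lemma linear_on_pure_tensor:
  assumes "is_vspace V" "is_vspace W"
  shows "v \<in> vcarrier V \<Longrightarrow> linear_on W (V \<otimes> W) (pure_tensor V W v)"
    and "w \<in> vcarrier W \<Longrightarrow> linear_on V (V \<otimes> W) (\<lambda>v. pure_tensor V W v w)"
  using bilinear_onD[OF bilinear_on_pure_tensor[OF assms]] by blast+

lemma tassoc:
  assumes V: "is_vspace V" and W: "is_vspace W" and U: "is_vspace U"
  shows "linear_on (V \<otimes> (W \<otimes> U)) ((V \<otimes> W) \<otimes> U) (tassoc V W U)"
    and "v \<in> vcarrier V \<Longrightarrow> w \<in> vcarrier W \<Longrightarrow> u \<in> vcarrier U \<Longrightarrow>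
      tassoc V W U (pure_tensor V (W \<otimes> U) v (pure_tensor W U w u)) =
      pure_tensor (V \<otimes> W) U (pure_tensor V W v w) u"
proof -
  let ?T = "(V \<otimes> W) \<otimes> U"
  let ?f = "\<lambda>v w u. pure_tensor (V \<otimes> W) U (pure_tensor V W v w) u"
  have bil: "bilinear_on W U ?T (?f v)" if "v \<in> vcarrier V" for v
    by (rule bilinear_on_comp[OF bilinear_on_pure_tensor[OF is_vspace_tensor U]
          linear_on_pure_tensor(1)[OF V W that] linear_on_id(2)])
  have lin: "linear_on V ?T (\<lambda>v. ?f v w u)" if "w \<in> vcarrier W" "u \<in> vcarrier U" for w u
    by (rule linear_on_comp[OF linear_on_pure_tensor(2)[OF is_vspace_tensor U that(2)]
          linear_on_pure_tensor(2)[OF V W that(1)]])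
  note lift = tlift[OF is_vspace_tensor bil]
  \<comment> \<open>Linearity in the inner tensor is that of the inner lift; linearity in
    \<open>v\<close> is linear dependence of that lift on its parameter.\<close>
  have "bilinear_on V (W \<otimes> U) ?T (\<lambda>v. tlift W U ?T (?f v))"
    by (intro bilinear_onI linear_on_tlift_param is_vspace_tensor V bil lin lift(1)) assumption+
  note lift' = tlift[OF is_vspace_tensor this]
  show "linear_on (V \<otimes> (W \<otimes> U)) ((V \<otimes> W) \<otimes> U) (tassoc V W U)"
    unfolding tassoc_def by (rule lift'(1))
  show "tassoc V W U (pure_tensor V (W \<otimes> U) v (pure_tensor W U w u)) = ?f v w u"
    if "v \<in> vcarrier V" "w \<in> vcarrier W" "u \<in> vcarrier U"
    unfolding tassoc_def using that by (simp add: lift' lift pure_tensor_in_tensor)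
qed

text \<open>Naturality: \<open>f \<otimes> g\<close> can be moved from the tensor into the bilinear
  map. \<open>pair_tendo\<close> uses this to pass to adjoints.\<close>

lemma tlift_tmap:
  assumes "is_vspace V'" "is_vspace W'" "is_vspace U" "linear_on V V' f" "linear_on W W' g"
    and h: "bilinear_on V' W' U h" and t: "t \<in> vcarrier (V \<otimes> W)"
  shows "tlift V' W' U h (tmap V W V' W' f g t) = tlift V W U (\<lambda>x y. h (f x) (g y)) t"
proof -
  note bil = bilinear_on_comp[OF h assms(4,5)]
  show ?thesis
    by (rule tensor_universal_unique[OF assms(3) linear_on_comp[OF tlift(1)[OF assms(3) h]
            tmap(1)[OF assms(1,2,4,5)]] tlift(1)[OF assms(3) bil] _ t])
      (simp add: tmap(2)[OF assms(1,2,4,5)] tlift(2)[OF assms(3) bil] tlift(2)[OF assms(3) h]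
        linear_onD(1)[OF assms(4)] linear_onD(1)[OF assms(5)])
qed

lemma linear_on_tmap_left:
  assumes "is_vspace X" "is_vspace V'" "is_vspace W'"
    and f: "bilinear_on X V V' f" and g: "linear_on W W' g" and t: "t \<in> vcarrier (V \<otimes> W)"
  shows "linear_on X (V' \<otimes> W') (\<lambda>x. tmap V W V' W' (f x) g t)"
  unfolding tmap_def
proof (rule linear_on_tlift_param[OF is_vspace_tensor _ _ assms(1) t])
  note P = bilinear_on_pure_tensor[OF assms(2,3)]
  show "bilinear_on V W (V' \<otimes> W') (\<lambda>v w. pure_tensor V' W' (f x v) (g w))"
    if "x \<in> vcarrier X" for x
    by (rule bilinear_on_comp[OF P bilinear_onD(1)[OF f that] g])
  show "linear_on X (V' \<otimes> W') (\<lambda>x. pure_tensor V' W' (f x v) (g w))"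
    if "v \<in> vcarrier V" "w \<in> vcarrier W" for v w
    by (rule linear_on_comp[OF bilinear_onD(2)[OF P linear_onD(1)[OF g that(2)]]
          bilinear_onD(2)[OF f that(1)]])
qed

lemma linear_on_tmap_right:
  assumes "is_vspace X" "is_vspace V'" "is_vspace W'"
    and f: "linear_on V V' f" and g: "bilinear_on X W W' g" and t: "t \<in> vcarrier (V \<otimes> W)"
  shows "linear_on X (V' \<otimes> W') (\<lambda>x. tmap V W V' W' f (g x) t)"
  unfolding tmap_def
proof (rule linear_on_tlift_param[OF is_vspace_tensor _ _ assms(1) t])
  note P = bilinear_on_pure_tensor[OF assms(2,3)]
  show "bilinear_on V W (V' \<otimes> W') (\<lambda>v w. pure_tensor V' W' (f v) (g x w))"
    if "x \<in> vcarrier X" for x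
    by (rule bilinear_on_comp[OF P f bilinear_onD(1)[OF g that]])
  show "linear_on X (V' \<otimes> W') (\<lambda>x. pure_tensor V' W' (f v) (g x w))"
    if "v \<in> vcarrier V" "w \<in> vcarrier W" for v w
    by (rule linear_on_comp[OF bilinear_onD(1)[OF P linear_onD(1)[OF f that(1)]]
          bilinear_onD(2)[OF g that(2)]])
qed

text \<open>Typically \<open>f x\<close> is multiplication by \<open>x\<close> and \<open>T\<close>
  is the comultiplication. The terms of the compatibility conditions become bilinear in the two
  algebra elements, so that they can be tested on pure tensors.\<close>

lemma bilinear_on_tmap_left:
  assumes "is_vspace X" "is_vspace V'" "is_vspace W'"
    and f: "bilinear_on X V V' f" and g: "linear_on W W' g" and T: "linear_on Y (V \<otimes> W) T"
  shows "bilinear_on X Y (V' \<otimes> W') (\<lambda>x y. tmap V W V' W' (f x) g (T y))"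
proof (rule bilinear_onI)
  show "linear_on Y (V' \<otimes> W') (\<lambda>y. tmap V W V' W' (f x) g (T y))" if "x \<in> vcarrier X" for x
    by (rule linear_on_comp[OF tmap(1)[OF assms(2,3) bilinear_onD(1)[OF f that] g] T])
  show "linear_on X (V' \<otimes> W') (\<lambda>x. tmap V W V' W' (f x) g (T y))" if "y \<in> vcarrier Y" for y
    by (rule linear_on_tmap_left[OF assms(1-3) f g linear_onD(1)[OF T that]])
qed

lemma bilinear_on_tmap_right:
  assumes "is_vspace X" "is_vspace V'" "is_vspace W'"
    and f: "linear_on V V' f" and g: "bilinear_on X W W' g" and T: "linear_on Y (V \<otimes> W) T"
  shows "bilinear_on X Y (V' \<otimes> W') (\<lambda>x y. tmap V W V' W' f (g x) (T y))"
proof (rule bilinear_onI)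
  show "linear_on Y (V' \<otimes> W') (\<lambda>y. tmap V W V' W' f (g x) (T y))" if "x \<in> vcarrier X" for x
    by (rule linear_on_comp[OF tmap(1)[OF assms(2,3) f bilinear_onD(1)[OF g that]] T])
  show "linear_on X (V' \<otimes> W') (\<lambda>x. tmap V W V' W' f (g x) (T y))" if "y \<in> vcarrier Y" for y
    by (rule linear_on_tmap_right[OF assms(1-3) f g linear_onD(1)[OF T that]])
qed

text \<open>The Leibniz compatibility condition adds left and right multiplication before tensoring
  with the identity, the anti-Leibniz one after it; this passes between the two forms.\<close>

lemma tmap_add_left:
  assumes V': "is_vspace V'" and W': "is_vspace W'"
    and f: "linear_on V V' f" and f': "linear_on V V' f'" and g: "linear_on W W' g"
    and t: "t \<in> vcarrier (V \<otimes> W)"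
  shows "tmap V W V' W' (f + f') g t = tmap V W V' W' f g t + tmap V W V' W' f' g t"
proof -
  have ff': "linear_on V V' (f + f')"
    using linear_on_add[OF V' f f'] by (simp add: plus_fun_def)
  note tm = tmap[OF V' W' _ g]
  show ?thesis
  proof (rule tensor_universal_unique[OF is_vspace_tensor tm(1)[OF ff']
        linear_on_add[OF is_vspace_tensor tm(1)[OF f] tm(1)[OF f']] _ t])
    fix v w assume vw: "v \<in> vcarrier V" "w \<in> vcarrier W"
    show "tmap V W V' W' (f + f') g (pure_tensor V W v w) =
      tmap V W V' W' f g (pure_tensor V W v w) + tmap V W V' W' f' g (pure_tensor V W v w)"
      using linear_onD(2)[OF linear_on_pure_tensor(2)[OF V' W' linear_onD(1)[OF g vw(2)]]
          linear_onD(1)[OF f vw(1)] linear_onD(1)[OF f' vw(1)]]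
      by (simp only: tm(2)[OF ff' vw] tm(2)[OF f vw] tm(2)[OF f' vw] plus_fun_apply)
  qed
qed


section \<open>Interleaving two tensor products\<close>

text \<open>
  The map \<open>(v\<^sub>1 \<otimes> v\<^sub>2, w\<^sub>1 \<otimes> w\<^sub>2) \<mapsto> f(v\<^sub>1, w\<^sub>1) \<otimes> g(v\<^sub>2, w\<^sub>2)\<close>.  Taking \<^const>\<open>pure_tensor\<close> for \<open>f\<close>
  and \<open>g\<close> gives \<^const>\<open>bullet\<close>, and taking \<^const>\<open>bullet\<close> for one of them gives its analogue for
  three factors.
\<close>

definition shuffle ::
  "('k::field, 'v1::ab_group_add) vspace \<Rightarrow> ('k, 'v2::ab_group_add) vspace \<Rightarrow>
   ('k, 'w1::ab_group_add) vspace \<Rightarrow> ('k, 'w2::ab_group_add) vspace \<Rightarrow>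
   ('k, 'u1::ab_group_add) vspace \<Rightarrow> ('k, 'u2::ab_group_add) vspace \<Rightarrow>
   ('v1 \<Rightarrow> 'w1 \<Rightarrow> 'u1) \<Rightarrow> ('v2 \<Rightarrow> 'w2 \<Rightarrow> 'u2) \<Rightarrow>
   (('v1 \<Rightarrow> 'v2 \<Rightarrow> 'k) \<Rightarrow> 'k) \<Rightarrow> (('w1 \<Rightarrow> 'w2 \<Rightarrow> 'k) \<Rightarrow> 'k) \<Rightarrow> (('u1 \<Rightarrow> 'u2 \<Rightarrow> 'k) \<Rightarrow> 'k)" where
  "shuffle V1 V2 W1 W2 U1 U2 f g p q =
     tlift V1 V2 (U1 \<otimes> U2) (\<lambda>v1 v2.
       tlift W1 W2 (U1 \<otimes> U2) (\<lambda>w1 w2. pure_tensor U1 U2 (f v1 w1) (g v2 w2)) q) p"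

lemma bullet_eq_shuffle:
  "bullet V W = shuffle V V W W (V \<otimes> W) (V \<otimes> W) (pure_tensor V W) (pure_tensor V W)"
  by (simp add: bullet_def shuffle_def fun_eq_iff)

lemma shuffle:
  assumes vs: "is_vspace V1" "is_vspace V2" "is_vspace U1" "is_vspace U2"
    and f: "bilinear_on V1 W1 U1 f" and g: "bilinear_on V2 W2 U2 g"
  shows "bilinear_on (V1 \<otimes> V2) (W1 \<otimes> W2) (U1 \<otimes> U2) (shuffle V1 V2 W1 W2 U1 U2 f g)"
    and "v1 \<in> vcarrier V1 \<Longrightarrow> v2 \<in> vcarrier V2 \<Longrightarrow> w1 \<in> vcarrier W1 \<Longrightarrow> w2 \<in> vcarrier W2 \<Longrightarrow>
      shuffle V1 V2 W1 W2 U1 U2 f g (pure_tensor V1 V2 v1 v2) (pure_tensor W1 W2 w1 w2) =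
      pure_tensor U1 U2 (f v1 w1) (g v2 w2)"
proof -
  let ?T = "U1 \<otimes> U2"
  let ?h = "\<lambda>v1 v2 w1 w2. pure_tensor U1 U2 (f v1 w1) (g v2 w2)"
  let ?H = "\<lambda>v1 v2. tlift W1 W2 ?T (?h v1 v2)"
  note P = bilinear_on_pure_tensor[OF vs(3,4)]
  have bil: "bilinear_on W1 W2 ?T (?h v1 v2)" if "v1 \<in> vcarrier V1" "v2 \<in> vcarrier V2" for v1 v2
    by (rule bilinear_on_comp[OF P bilinear_onD(1)[OF f that(1)] bilinear_onD(1)[OF g that(2)]])
  note lift = tlift[OF is_vspace_tensor bil]
  have bil': "bilinear_on V1 V2 ?T (\<lambda>v1 v2. ?h v1 v2 w1 w2)"
    if "w1 \<in> vcarrier W1" "w2 \<in> vcarrier W2" for w1 w2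
    by (rule bilinear_on_comp[OF P bilinear_onD(2)[OF f that(1)] bilinear_onD(2)[OF g that(2)]])
  \<comment> \<open>The second tensor stays fixed while the first is lifted. \<open>bil\<close>
    gives bilinearity in the \<open>w\<close>'s and \<open>bil'\<close> linearity in the
    \<open>v\<close>'s, the two inputs of \<open>linear_on_tlift_param\<close>.\<close>
  have outer: "bilinear_on V1 V2 ?T (\<lambda>v1 v2. ?H v1 v2 q)" if "q \<in> vcarrier (W1 \<otimes> W2)" for q
  proof (rule bilinear_onI)
    show "linear_on V2 ?T (\<lambda>v2. ?H v1 v2 q)" if "v1 \<in> vcarrier V1" for v1
      by (rule linear_on_tlift_param[OF is_vspace_tensor bil[OF that] _ vs(2) \<open>q \<in> _\<close>])
        (auto intro: bilinear_onD(1)[OF bil' that])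
    show "linear_on V1 ?T (\<lambda>v1. ?H v1 v2 q)" if "v2 \<in> vcarrier V2" for v2
      by (rule linear_on_tlift_param[OF is_vspace_tensor bil[OF _ that] _ vs(1) \<open>q \<in> _\<close>])
        (auto intro: bilinear_onD(2)[OF bil' that])
  qed
  note lift' = tlift[OF is_vspace_tensor outer]
  show "bilinear_on (V1 \<otimes> V2) (W1 \<otimes> W2) ?T (shuffle V1 V2 W1 W2 U1 U2 f g)"
    unfolding shuffle_def
    by (intro bilinear_onI linear_on_tlift_param lift'(1) is_vspace_tensor outer lift(1)) assumption+
  show "shuffle V1 V2 W1 W2 U1 U2 f g (pure_tensor V1 V2 v1 v2) (pure_tensor W1 W2 w1 w2) =
      pure_tensor U1 U2 (f v1 w1) (g v2 w2)"
    if "v1 \<in> vcarrier V1" "v2 \<in> vcarrier V2" "w1 \<in> vcarrier W1" "w2 \<in> vcarrier W2"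
    unfolding shuffle_def using that
    by (simp add: lift'(2) lift(2) pure_tensor_in_tensor)
qed

text \<open>Naturality of the interleaving, clear on pure tensors from \<open>Ff\<close> and
  \<open>Gg\<close>. It covers the multiplication operators, the flip of the first two of three
  factors, and the comultiplication, for which \<open>f'\<close> or \<open>g'\<close> is itself a
  bullet.\<close>

lemma tmap_shuffle:
  assumes vs: "is_vspace V1" "is_vspace V2" "is_vspace U1" "is_vspace U2"
    and vs': "is_vspace V1'" "is_vspace V2'" "is_vspace W1'" "is_vspace W2'" "is_vspace U1'" "is_vspace U2'"
    and f: "bilinear_on V1 W1 U1 f" and g: "bilinear_on V2 W2 U2 g"
    and f': "bilinear_on V1' W1' U1' f'" and g': "bilinear_on V2' W2' U2' g'"
    and F: "linear_on U1 U1' F" and G: "linear_on U2 U2' G"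
    and F1: "linear_on V1 V1' F1" and G1: "linear_on V2 V2' G1"
    and F2: "linear_on W1 W1' F2" and G2: "linear_on W2 W2' G2"
    and Ff: "\<And>v w. v \<in> vcarrier V1 \<Longrightarrow> w \<in> vcarrier W1 \<Longrightarrow> F (f v w) = f' (F1 v) (F2 w)"
    and Gg: "\<And>v w. v \<in> vcarrier V2 \<Longrightarrow> w \<in> vcarrier W2 \<Longrightarrow> G (g v w) = g' (G1 v) (G2 w)"
    and p: "p \<in> vcarrier (V1 \<otimes> V2)" and q: "q \<in> vcarrier (W1 \<otimes> W2)"
  shows "tmap U1 U2 U1' U2' F G (shuffle V1 V2 W1 W2 U1 U2 f g p q) =
    shuffle V1' V2' W1' W2' U1' U2' f' g'
      (tmap V1 V2 V1' V2' F1 G1 p) (tmap W1 W2 W1' W2' F2 G2 q)"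
proof -
  note s = shuffle[OF vs f g] and s' = shuffle[OF vs'(1,2,5,6) f' g']
  note T = tmap[OF vs'(5,6) F G] and T1 = tmap[OF vs'(1,2) F1 G1] and T2 = tmap[OF vs'(3,4) F2 G2]
  show ?thesis
  proof (rule bilinear_unique[OF is_vspace_tensor linear_on_bilinear_on[OF T(1) s(1)]
        bilinear_on_comp[OF s'(1) T1(1) T2(1)] _ p q])
  qed (simp add: s(2) s'(2) T(2) T1(2) T2(2) Ff Gg linear_onD(1)[OF F1] linear_onD(1)[OF F2]
      linear_onD(1)[OF G1] linear_onD(1)[OF G2] bilinear_onD(3)[OF f] bilinear_onD(3)[OF g])
qed

lemma tswap_shuffle:
  assumes vs: "is_vspace V1" "is_vspace V2" "is_vspace W1" "is_vspace W2" "is_vspace U1" "is_vspace U2"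
    and f: "bilinear_on V1 W1 U1 f" and g: "bilinear_on V2 W2 U2 g"
    and p: "p \<in> vcarrier (V1 \<otimes> V2)" and q: "q \<in> vcarrier (W1 \<otimes> W2)"
  shows "tswap U1 U2 (shuffle V1 V2 W1 W2 U1 U2 f g p q) =
    shuffle V2 V1 W2 W1 U2 U1 g f (tswap V1 V2 p) (tswap W1 W2 q)"
proof -
  note s = shuffle[OF vs(1,2,5,6) f g] and s' = shuffle[OF vs(2,1,6,5) g f]
  note T = tswap[OF vs(5,6)] and T1 = tswap[OF vs(1,2)] and T2 = tswap[OF vs(3,4)]
  show ?thesis
  proof (rule bilinear_unique[OF is_vspace_tensor linear_on_bilinear_on[OF T(1) s(1)]
        bilinear_on_comp[OF s'(1) T1(1) T2(1)] _ p q])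
  qed (simp add: s(2) s'(2) T(2) T1(2) T2(2) bilinear_onD(3)[OF f] bilinear_onD(3)[OF g])
qed

text \<open>The bullet of threefold tensors has a right-nested and a left-nested form; reassociation
  carries one to the other, since both come from the same three maps \<open>f\<close>,
  \<open>g\<close>, \<open>h\<close> on pure tensors.\<close>

lemma tassoc_shuffle:
  assumes vs: "is_vspace V1" "is_vspace V2" "is_vspace V3" "is_vspace W1" "is_vspace W2"
      "is_vspace W3" "is_vspace U1" "is_vspace U2" "is_vspace U3"
    and f: "bilinear_on V1 W1 U1 f" and g: "bilinear_on V2 W2 U2 g" and h: "bilinear_on V3 W3 U3 h"
    and p: "p \<in> vcarrier (V1 \<otimes> (V2 \<otimes> V3))" and q: "q \<in> vcarrier (W1 \<otimes> (W2 \<otimes> W3))"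
  shows "tassoc U1 U2 U3 (shuffle V1 (V2 \<otimes> V3) W1 (W2 \<otimes> W3) U1 (U2 \<otimes> U3)
      f (shuffle V2 V3 W2 W3 U2 U3 g h) p q) =
    shuffle (V1 \<otimes> V2) V3 (W1 \<otimes> W2) W3 (U1 \<otimes> U2) U3 (shuffle V1 V2 W1 W2 U1 U2 f g) h
      (tassoc V1 V2 V3 p) (tassoc W1 W2 W3 q)"
proof -
  let ?F = "\<lambda>p q. tassoc U1 U2 U3 (shuffle V1 (V2 \<otimes> V3) W1 (W2 \<otimes> W3) U1 (U2 \<otimes> U3)
    f (shuffle V2 V3 W2 W3 U2 U3 g h) p q)"
  let ?G = "\<lambda>p q. shuffle (V1 \<otimes> V2) V3 (W1 \<otimes> W2) W3 (U1 \<otimes> U2) U3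
    (shuffle V1 V2 W1 W2 U1 U2 f g) h (tassoc V1 V2 V3 p) (tassoc W1 W2 W3 q)"
  note t = is_vspace_tensor
  note s23 = shuffle[OF vs(2,3,8,9) g h] and s12 = shuffle[OF vs(1,2,7,8) f g]
  note S = shuffle[OF vs(1) t vs(7) t f s23(1)] and S' = shuffle[OF t vs(3) t vs(9) s12(1) h]
  note T = tassoc[OF vs(7,8,9)] and T1 = tassoc[OF vs(1,2,3)] and T2 = tassoc[OF vs(4,5,6)]
  note F = linear_on_bilinear_on[OF T(1) S(1)] and G = bilinear_on_comp[OF S'(1) T1(1) T2(1)]
  show ?thesis
  proof (rule bilinear_unique[OF t F G _ p q])
    fix v1 p' w1 q'
    assume v1: "v1 \<in> vcarrier V1" and w1: "w1 \<in> vcarrier W1"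
      and p': "p' \<in> vcarrier (V2 \<otimes> V3)" and q': "q' \<in> vcarrier (W2 \<otimes> W3)"
    \<comment> \<open>\<open>P\<close> and \<open>Q\<close> insert the fixed first factors
      \<open>v1\<close> and \<open>w1\<close>. After composition with them both sides are bilinear
      in the remaining tensors, and uniqueness applies a second time.\<close>
    note P = linear_on_pure_tensor(1)[OF vs(1) t v1] and Q = linear_on_pure_tensor(1)[OF vs(4) t w1]
    show "?F (pure_tensor V1 (V2 \<otimes> V3) v1 p') (pure_tensor W1 (W2 \<otimes> W3) w1 q') =
      ?G (pure_tensor V1 (V2 \<otimes> V3) v1 p') (pure_tensor W1 (W2 \<otimes> W3) w1 q')"
    proof (rule bilinear_unique[OF t bilinear_on_comp[OF F P Q] bilinear_on_comp[OF G P Q] _ p' q'])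
    qed (simp add: v1 w1 S(2) S'(2) s23(2) s12(2) T(2) T1(2) T2(2) pure_tensor_in_tensor
        bilinear_onD(3)[OF f] bilinear_onD(3)[OF g] bilinear_onD(3)[OF h])
  qed
qed


section \<open>Finite-dimensional tensor products\<close>

text \<open>A finite spanning set contains a basis \<open>E\<close>, and \<open>c e\<close> is the
  coordinate functional at \<open>e\<close>. The reconstruction formula is the form in which bases
  enter below.\<close>

lemma fd_vspace_coordinates:
  assumes "fd_vspace V"
  obtains E c where "finite E" "E \<subseteq> vcarrier V" "\<And>e. linear_on V base_field (c e)"
    "\<And>v. v \<in> vcarrier V \<Longrightarrow> v = (\<Sum>e\<in>E. vscale V (c e v) e)"
proof -
  obtain S where vs: "vector_space (vscale V)" and S: "finite S" "vcarrier V = module.span (vscale V) S"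
    using assms by (auto simp: fd_vspace_def)
  interpret vector_space "vscale V" by (rule vs)
  obtain E where E: "E \<subseteq> S" "independent E" "S \<subseteq> span E"
    using maximal_independent_subset by blast
  have span: "span E = vcarrier V"
    using E(1,3) S(2) span_mono span_minimal subspace_span by (metis subset_antisym)
  have fin: "finite E" using E(1) S(1) finite_subset by blast
  show ?thesis
  proof (rule that[OF fin])
    show "E \<subseteq> vcarrier V" using span span_superset by blast
    show "linear_on V base_field (\<lambda>v. representation E v e)" for e
      by (intro linear_onI)
        (simp_all add: representation_add[OF E(2)] representation_scale[OF E(2)] span)
    show "v = (\<Sum>e\<in>E. vscale V (representation E v e) e)" if "v \<in> vcarrier V" for v
      using sum_representation_eq[OF E(2) _ fin] that span by auto
  qed
qed

text \<open>Expanding \<open>v\<close> and then \<open>w\<close> in coordinates writes a pure tensor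
  through the finitely many basis tensors. This gives the finite dimension that an anti-Leibniz
  algebra must have.\<close>

lemma fd_vspace_tensor:
  assumes V: "fd_vspace V" and W: "fd_vspace W"
  shows "fd_vspace (V \<otimes> W)"
proof -
  interpret vector_space fun_scale by (rule vector_space_fun_scale)
  note vV = fd_vspace_imp_is_vspace[OF V] and vW = fd_vspace_imp_is_vspace[OF W]
  obtain E c where E: "finite E" "E \<subseteq> vcarrier V" "\<And>e. linear_on V base_field (c e)"
    "\<And>v. v \<in> vcarrier V \<Longrightarrow> v = (\<Sum>e\<in>E. vscale V (c e v) e)"
    using fd_vspace_coordinates[OF V] by blast
  obtain F d where F: "finite F" "F \<subseteq> vcarrier W" "\<And>e. linear_on W base_field (d e)"
    "\<And>v. v \<in> vcarrier W \<Longrightarrow> v = (\<Sum>e\<in>F. vscale W (d e v) e)"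
    using fd_vspace_coordinates[OF W] by blast
  let ?P = "\<lambda>(e, f). pure_tensor V W e f"
  note P = linear_on_pure_tensor[OF vV vW]
  have "pure_tensor V W v w \<in> span (?P ` (E \<times> F))" if v: "v \<in> vcarrier V" and w: "w \<in> vcarrier W" for v w
  proof -
    have "pure_tensor V W v w = (\<Sum>e\<in>E. \<Sum>f\<in>F. fun_scale (c e v * d f w) (pure_tensor V W e f))"
    proof -
      have "pure_tensor V W v w = pure_tensor V W (\<Sum>e\<in>E. vscale V (c e v) e) w"
        using E(4)[OF v] by simp
      also have "\<dots> = (\<Sum>e\<in>E. fun_scale (c e v) (pure_tensor V W e w))"
        using E(2) linear_onD(3)[OF P(2)[OF w]]
        by (subst linear_on_apply_sum[OF P(2)[OF w] vV is_vspace_tensor]) (auto intro!: sum.cong is_vspaceD(3)[OF vV])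
      also have "\<dots> = (\<Sum>e\<in>E. fun_scale (c e v) (\<Sum>f\<in>F. fun_scale (d f w) (pure_tensor V W e f)))"
      proof (rule sum.cong[OF refl])
        fix e assume "e \<in> E"
        then have e: "e \<in> vcarrier V" using E(2) by blast
        have "pure_tensor V W e w = pure_tensor V W e (\<Sum>f\<in>F. vscale W (d f w) f)"
          using F(4)[OF w] by simp
        also have "\<dots> = (\<Sum>f\<in>F. fun_scale (d f w) (pure_tensor V W e f))"
          using F(2) linear_onD(3)[OF P(1)[OF e]]
          by (subst linear_on_apply_sum[OF P(1)[OF e] vW is_vspace_tensor]) (auto intro!: sum.cong is_vspaceD(3)[OF vW])
        finally show "fun_scale (c e v) (pure_tensor V W e w) =
          fun_scale (c e v) (\<Sum>f\<in>F. fun_scale (d f w) (pure_tensor V W e f))" by simp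
      qed
      finally show ?thesis by (simp add: scale_sum_right)
    qed
    also have "\<dots> \<in> span (?P ` (E \<times> F))"
      by (intro span_sum span_scale span_base) auto
    finally show ?thesis .
  qed
  then have "span {pure_tensor V W v w | v w. v \<in> vcarrier V \<and> w \<in> vcarrier W} = span (?P ` (E \<times> F))"
    using E(2) F(2) by (intro subset_antisym span_minimal subspace_span) (auto 4 4 intro: span_base)
  moreover have "finite (?P ` (E \<times> F))" using E(1) F(1) by simp
  ultimately show ?thesis
    using vector_space_fun_scale by (auto simp: fd_vspace_def tensor_def)
qed

text \<open>
  Only one factor need be finite-dimensional: with a basis \<open>e\<close> of \<open>W\<close>, a tensor is
  \<open>\<Sum> v\<^sub>e \<otimes> e\<close>, and every \<open>\<phi> i\<close> kills \<open>v\<^sub>e\<close> because \<open>(\<phi> i \<otimes> id) t\<close> is killed by every \<open>\<psi> j\<close>.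
\<close>

lemma tensor_eq_0I:
  assumes V: "is_vspace V" and W: "fd_vspace W"
    and \<phi>: "\<And>i. i \<in> I \<Longrightarrow> linear_on V base_field (\<phi> i)"
    and \<phi>0: "\<forall>v\<in>vcarrier V. (\<forall>i\<in>I. \<phi> i v = 0) \<longrightarrow> v = 0"
    and \<psi>: "\<And>j. j \<in> J \<Longrightarrow> linear_on W base_field (\<psi> j)"
    and \<psi>0: "\<forall>w\<in>vcarrier W. (\<forall>j\<in>J. \<psi> j w = 0) \<longrightarrow> w = 0"
    and t: "t \<in> vcarrier (V \<otimes> W)"
    and t0: "\<And>i j. i \<in> I \<Longrightarrow> j \<in> J \<Longrightarrow> tlift V W base_field (\<lambda>v w. \<phi> i v * \<psi> j w) t = 0"
  shows "t = 0"
proof -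
  note vW = fd_vspace_imp_is_vspace[OF W] and k = is_vspace_base_field
  obtain E c where E: "finite E" "E \<subseteq> vcarrier W" "\<And>e. linear_on W base_field (c e)"
    "\<And>w. w \<in> vcarrier W \<Longrightarrow> w = (\<Sum>e\<in>E. vscale W (c e w) e)"
    using fd_vspace_coordinates[OF W] by blast
  have bL: "bilinear_on V W V (\<lambda>v w. vscale V (\<psi>' w) v)" if "linear_on W base_field \<psi>'" for \<psi>'
    using that by (intro bilinear_onI linear_on_form_scale V linear_on_scale linear_on_id)
  have bR: "bilinear_on V W W (\<lambda>v w. vscale W (\<phi>' v) w)" if "linear_on V base_field \<phi>'" for \<phi>'
    using that by (intro bilinear_onI linear_on_form_scale vW linear_on_scale linear_on_id)
  note liftL = tlift[OF V bL] and liftR = tlift[OF vW bR]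
  note liftk = tlift[OF k bilinear_on_mult_forms]
  \<comment> \<open>The lift is \<open>(\<phi> i \<otimes> id) t\<close>, an element of
    \<open>W\<close>; applying \<open>\<psi> j\<close> to it gives
    \<open>(\<phi> i \<otimes> \<psi> j) t\<close>, which is 0 by \<open>t0\<close>.\<close>
  have R0: "tlift V W W (\<lambda>v w. vscale W (\<phi> i v) w) t = 0" if i: "i \<in> I" for i
  proof (rule \<psi>0[rule_format])
    show "tlift V W W (\<lambda>v w. vscale W (\<phi> i v) w) t \<in> vcarrier W"
      by (rule linear_onD(1)[OF liftR(1)[OF \<phi>[OF i]] t])
    fix j assume j: "j \<in> J"
    have "\<psi> j (tlift V W W (\<lambda>v w. vscale W (\<phi> i v) w) t) = tlift V W base_field (\<lambda>v w. \<phi> i v * \<psi> j w) t"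
      by (rule tensor_universal_unique[OF k linear_on_comp[OF \<psi>[OF j] liftR(1)[OF \<phi>[OF i]]]
            liftk(1)[OF \<phi>[OF i] \<psi>[OF j]] _ t])
        (simp add: liftR(2)[OF \<phi>[OF i]] liftk(2)[OF \<phi>[OF i] \<psi>[OF j]] linear_onD(3)[OF \<psi>[OF j]])
    then show "\<psi> j (tlift V W W (\<lambda>v w. vscale W (\<phi> i v) w) t) = 0"
      using t0[OF i j] by simp
  qed
  \<comment> \<open>The lift is \<open>(id \<otimes> c e) t\<close>, the coefficient of
    \<open>e\<close> in \<open>t\<close>. Applying \<open>\<phi> i\<close> to it, or
    \<open>c e\<close> to \<open>(\<phi> i \<otimes> id) t\<close>, gives the same scalar
    \<open>(\<phi> i \<otimes> c e) t\<close>.\<close>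
  have L0: "tlift V W V (\<lambda>v w. vscale V (c e w) v) t = 0" for e
  proof (rule \<phi>0[rule_format])
    show "tlift V W V (\<lambda>v w. vscale V (c e w) v) t \<in> vcarrier V"
      by (rule linear_onD(1)[OF liftL(1)[OF E(3)] t])
    fix i assume i: "i \<in> I"
    have "\<phi> i (tlift V W V (\<lambda>v w. vscale V (c e w) v) t) = c e (tlift V W W (\<lambda>v w. vscale W (\<phi> i v) w) t)"
      by (rule tensor_universal_unique[OF k linear_on_comp[OF \<phi>[OF i] liftL(1)[OF E(3)]]
            linear_on_comp[OF E(3) liftR(1)[OF \<phi>[OF i]]] _ t])
        (simp add: liftL(2)[OF E(3)] liftR(2)[OF \<phi>[OF i]] linear_onD(3)[OF E(3)]
          linear_onD(3)[OF \<phi>[OF i]])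
    then show "\<phi> i (tlift V W V (\<lambda>v w. vscale V (c e w) v) t) = 0"
      using linear_on_0[OF E(3) vW k] by (simp add: R0[OF i])
  qed
  have lin: "linear_on V (V \<otimes> W) (\<lambda>v. pure_tensor V W v e)" if "e \<in> E" for e
    using linear_on_pure_tensor(2)[OF V vW] E(2) that by blast
  have "t = (\<Sum>e\<in>E. pure_tensor V W (tlift V W V (\<lambda>v w. vscale V (c e w) v) t) e)"
  proof (rule tensor_universal_unique[OF is_vspace_tensor linear_on_id(2) linear_on_sum[OF is_vspace_tensor
          linear_on_comp[OF lin liftL(1)[OF E(3)]]] _ t])
    fix v w assume v: "v \<in> vcarrier V" and w: "w \<in> vcarrier W"
    note lv = linear_on_pure_tensor(1)[OF V vW v]
    have "pure_tensor V W v w = pure_tensor V W v (\<Sum>e\<in>E. vscale W (c e w) e)"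
      using E(4)[OF w] by simp
    also have "\<dots> = (\<Sum>e\<in>E. pure_tensor V W v (vscale W (c e w) e))"
      using E(2) by (intro linear_on_apply_sum[OF lv vW is_vspace_tensor] is_vspaceD(3)[OF vW]) auto
    also have "\<dots> = (\<Sum>e\<in>E. pure_tensor V W (vscale V (c e w) v) e)"
      using E(2) by (intro sum.cong) (auto simp: linear_onD(3)[OF lv] linear_onD(3)[OF lin] v)
    finally show "pure_tensor V W v w =
      (\<Sum>e\<in>E. pure_tensor V W (tlift V W V (\<lambda>v w. vscale V (c e w) v) (pure_tensor V W v w)) e)"
      unfolding liftL(2)[OF E(3) v w] .
  qed
  also have "\<dots> = 0"
    using linear_on_0[OF lin V is_vspace_tensor] by (simp add: L0)
  finally show ?thesis .
qed

text \<open>Products of two separating families of functionals separate the tensor product. The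
  index sets are arbitrary: vectors of \<open>B\<close> will index functionals on \<open>B\<close>,
  and pairs of vectors functionals on \<open>B \<otimes> B\<close>.\<close>

lemma tensor_eqI:
  assumes V: "is_vspace V" and W: "fd_vspace W"
    and \<phi>: "\<And>i. i \<in> I \<Longrightarrow> linear_on V base_field (\<phi> i)"
    and \<phi>0: "\<forall>v\<in>vcarrier V. (\<forall>i\<in>I. \<phi> i v = 0) \<longrightarrow> v = 0"
    and \<psi>: "\<And>j. j \<in> J \<Longrightarrow> linear_on W base_field (\<psi> j)"
    and \<psi>0: "\<forall>w\<in>vcarrier W. (\<forall>j\<in>J. \<psi> j w = 0) \<longrightarrow> w = 0"
    and t: "t \<in> vcarrier (V \<otimes> W)" "t' \<in> vcarrier (V \<otimes> W)"
    and eq: "\<And>i j. i \<in> I \<Longrightarrow> j \<in> J \<Longrightarrow>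
      tlift V W base_field (\<lambda>v w. \<phi> i v * \<psi> j w) t = tlift V W base_field (\<lambda>v w. \<phi> i v * \<psi> j w) t'"
  shows "t = t'"
proof -
  note k = is_vspace_base_field
  have "t - t' = 0"
  proof (rule tensor_eq_0I[OF V W \<phi> \<phi>0 \<psi> \<psi>0 is_vspace_diff[OF is_vspace_tensor t]])
    show "tlift V W base_field (\<lambda>v w. \<phi> i v * \<psi> j w) (t - t') = 0" if "i \<in> I" "j \<in> J" for i j
      using linear_on_minus[OF tlift(1)[OF k bilinear_on_mult_forms[OF \<phi>[OF that(1)] \<psi>[OF that(2)]]]
          is_vspace_tensor k t] eq[OF that] by simp
  qed
  then show ?thesis by simp
qed


section \<open>The coalgebra dual to a quadratic algebra\<close>

locale quadratic_acaa_comult =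
  fixes B :: "('k::field, 'b::ab_group_add) vspace"
    and m :: "'b \<Rightarrow> 'b \<Rightarrow> 'b" and \<omega> :: "'b \<Rightarrow> 'b \<Rightarrow> 'k" and D :: "'b \<Rightarrow> (('b \<Rightarrow> 'b \<Rightarrow> 'k) \<Rightarrow> 'k)"
  assumes quadratic: "quadratic_acaa_algebra B m \<omega>"
    and comult_in: "b \<in> vcarrier B \<Longrightarrow> D b \<in> vcarrier (B \<otimes> B)"
    and comult_form: "b \<in> vcarrier B \<Longrightarrow> u \<in> vcarrier B \<Longrightarrow> v \<in> vcarrier B \<Longrightarrow>
      tensor_form B \<omega> (D b) (pure_tensor B B u v) = \<omega> b (m u v)"
begin

section \<open>Identities in the quadratic algebra\<close>

lemma fd: "fd_vspace B"
  and mult: "bilinear_on B B B m"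
  and form: "bilinear_form B B \<omega>"
  using quadratic unfolding quadratic_acaa_algebra_def acaa_algebra_def fd_algebra_def by blast+

lemmas vs = fd_vspace_imp_is_vspace[OF fd]

lemma mult_closed: "x \<in> vcarrier B \<Longrightarrow> y \<in> vcarrier B \<Longrightarrow> m x y \<in> vcarrier B"
  using bilinear_onD(3)[OF mult] .

lemma mult_skew: "x \<in> vcarrier B \<Longrightarrow> y \<in> vcarrier B \<Longrightarrow> m x y = - m y x"
  and mult_assoc: "x \<in> vcarrier B \<Longrightarrow> y \<in> vcarrier B \<Longrightarrow> z \<in> vcarrier B \<Longrightarrow>
    m x (m y z) = - m (m x y) z"
  and form_sym: "x \<in> vcarrier B \<Longrightarrow> y \<in> vcarrier B \<Longrightarrow> \<omega> x y = \<omega> y x"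
  and form_nondegenerate: "\<forall>x\<in>vcarrier B. (\<forall>y\<in>vcarrier B. \<omega> x y = 0) \<longrightarrow> x = 0"
  and form_invariant: "x \<in> vcarrier B \<Longrightarrow> y \<in> vcarrier B \<Longrightarrow> z \<in> vcarrier B \<Longrightarrow>
    \<omega> (m x y) z = \<omega> x (m y z)"
  using quadratic unfolding quadratic_acaa_algebra_def acaa_algebra_def by blast+

lemma mult_uminus_left: "x \<in> vcarrier B \<Longrightarrow> y \<in> vcarrier B \<Longrightarrow> m (- x) y = - m x y"
  by (rule linear_on_neg[OF bilinear_onD(2)[OF mult] vs vs])

lemma form_uminus_right: "x \<in> vcarrier B \<Longrightarrow> y \<in> vcarrier B \<Longrightarrow> \<omega> x (- y) = - \<omega> x y"
  by (rule linear_on_neg[OF bilinear_onD(1)[OF form] vs is_vspace_base_field])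

lemma form_left: "u \<in> vcarrier B \<Longrightarrow> linear_on B base_field (\<lambda>x. \<omega> x u)"
  by (rule bilinear_onD(2)[OF form])

text \<open>x(yz) = -(xy)z = (yx)z = -y(xz). Together with anti-commutativity and anti-associativity
  this makes triple products totally antisymmetric.\<close>

lemma mult_left_skew:
  assumes "x \<in> vcarrier B" "y \<in> vcarrier B" "z \<in> vcarrier B"
  shows "m x (m y z) = - m y (m x z)"
  using mult_assoc[OF assms] mult_assoc[OF assms(2,1,3)] mult_skew[OF assms(1,2)]
    mult_uminus_left[OF mult_closed[OF assms(2,1)] assms(3)]
  by simp

section \<open>Pairing tensors in \<open>B \<otimes> B\<close> with pure tensors\<close>

text \<open>The functional \<open>\<omega>(-, u \<otimes> v)\<close> on
  \<open>B \<otimes> B\<close>. With \<open>u\<close> and \<open>v\<close> as separate arguments it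
  is a single lift of a product of forms, the shape that \<open>tensor_eqI\<close> handles.\<close>

definition pair :: "'b \<Rightarrow> 'b \<Rightarrow> (('b \<Rightarrow> 'b \<Rightarrow> 'k) \<Rightarrow> 'k) \<Rightarrow> 'k" where
  "pair u v = tlift B B base_field (\<lambda>x y. \<omega> x u * \<omega> y v)"

lemma pair:
  assumes "u \<in> vcarrier B" "v \<in> vcarrier B"
  shows "linear_on (B \<otimes> B) base_field (pair u v)"
    and "x \<in> vcarrier B \<Longrightarrow> y \<in> vcarrier B \<Longrightarrow> pair u v (pure_tensor B B x y) = \<omega> x u * \<omega> y v"
  unfolding pair_def
  using tlift[OF is_vspace_base_field bilinear_on_mult_forms[OF form_left[OF assms(1)] form_left[OF assms(2)]]]
  by blast+

lemma pair_uminus: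
  "u \<in> vcarrier B \<Longrightarrow> v \<in> vcarrier B \<Longrightarrow> t \<in> vcarrier (B \<otimes> B) \<Longrightarrow> pair u v (- t) = - pair u v t"
  by (rule linear_on_neg[OF pair(1) is_vspace_tensor is_vspace_base_field])

lemma pair_comult:
  assumes b: "b \<in> vcarrier B" and u: "u \<in> vcarrier B" and v: "v \<in> vcarrier B"
  shows "pair u v (D b) = \<omega> b (m u v)"
proof -
  \<comment> \<open>The inner lift of \<open>tensor_form\<close> at a pure tensor is evaluated for
    \<open>x\<close>, \<open>y\<close> in the carrier, which suffices for
    \<open>tlift_cong\<close>.\<close>
  have "tlift B B base_field (\<lambda>w1 w2. \<omega> x w1 * \<omega> y w2) (pure_tensor B B u v) = \<omega> x u * \<omega> y v"
    if "x \<in> vcarrier B" "y \<in> vcarrier B" for x y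
    using that u v bilinear_onD(1)[OF form]
    by (intro tlift(2) is_vspace_base_field bilinear_on_mult_forms)
  then have "pair u v (D b) = tensor_form B \<omega> (D b) (pure_tensor B B u v)"
    unfolding pair_def tensor_form_def by (subst tlift_cong) auto
  then show ?thesis using comult_form assms by simp
qed

text \<open>By nondegeneracy the functionals \<open>\<omega>(-, u)\<close> separate
  \<open>B\<close>, so their products separate \<open>B \<otimes> B\<close>.\<close>

lemma pair_eqI:
  assumes "t \<in> vcarrier (B \<otimes> B)" "t' \<in> vcarrier (B \<otimes> B)"
    and "\<And>u v. u \<in> vcarrier B \<Longrightarrow> v \<in> vcarrier B \<Longrightarrow> pair u v t = pair u v t'"
  shows "t = t'"
proof -
  have *: "tlift B B base_field (\<lambda>x y. \<omega> x u * \<omega> y v) t = tlift B B base_field (\<lambda>x y. \<omega> x u * \<omega> y v) t'"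
    if "u \<in> vcarrier B" "v \<in> vcarrier B" for u v
    using assms(3)[OF that] unfolding pair_def .
  show ?thesis
    by (rule tensor_eqI[where I = "vcarrier B" and J = "vcarrier B" and \<phi> = "\<lambda>u x. \<omega> x u"
      and \<psi> = "\<lambda>u x. \<omega> x u", OF vs fd form_left form_nondegenerate form_left form_nondegenerate
      assms(1,2) *])
qed

text \<open>Linearity of \<open>D\<close> follows from its defining pairing:
  \<open>\<omega> b (m u v)\<close> is linear in \<open>b\<close>, and pairings determine a
  tensor.\<close>

lemma linear_on_comult: "linear_on B (B \<otimes> B) D"
proof (rule linear_onI)
  show "D (x + y) = D x + D y" if "x \<in> vcarrier B" "y \<in> vcarrier B" for x y
    using that
    by (intro pair_eqI)
      (simp_all add: comult_in is_vspaceD[OF vs] is_vspaceD[OF is_vspace_tensor]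
        linear_onD(2)[OF pair(1)] pair_comult linear_onD(2)[OF form_left] mult_closed)
  show "D (vscale B c x) = vscale (B \<otimes> B) c (D x)" if "x \<in> vcarrier B" for c x
    using that
    by (intro pair_eqI)
      (simp_all add: comult_in is_vspaceD[OF vs] is_vspaceD(3)[OF is_vspace_tensor, simplified]
        linear_onD(3)[OF pair(1), simplified] pair_comult linear_onD(3)[OF form_left] mult_closed)
qed (rule comult_in)

section \<open>Multiplication operators, their adjoints, and the comultiplication\<close>

lemma linear_on_lmul: "b \<in> vcarrier B \<Longrightarrow> linear_on B B (lmul m b)"
  and linear_on_rmul: "b \<in> vcarrier B \<Longrightarrow> linear_on B B (rmul m b)"
  using bilinear_onD[OF mult] by (auto simp: lmul_def rmul_def)

text \<open>Passing to adjoints in each slot. Only the values \<open>u'\<close> and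
  \<open>v'\<close> of the adjoints at the given \<open>u\<close> and \<open>v\<close> enter, so no
  adjoint map has to be constructed.\<close>

lemma pair_tendo:
  assumes "linear_on B B f" "linear_on B B g" and t: "t \<in> vcarrier (B \<otimes> B)"
    and "u \<in> vcarrier B" "v \<in> vcarrier B"
    and "\<And>x. x \<in> vcarrier B \<Longrightarrow> \<omega> (f x) u = \<omega> x u'" "\<And>x. x \<in> vcarrier B \<Longrightarrow> \<omega> (g x) v = \<omega> x v'"
  shows "pair u v (tendo B f g t) = pair u' v' t"
proof -
  have "pair u v (tendo B f g t) = tlift B B base_field (\<lambda>x y. \<omega> (f x) u * \<omega> (g y) v) t"
    unfolding pair_def using assms
    by (intro tlift_tmap vs is_vspace_base_field bilinear_on_mult_forms form_left)
  also have "\<dots> = pair u' v' t"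
    unfolding pair_def using assms(6,7) by (intro fun_cong[OF tlift_cong]) simp
  finally show ?thesis .
qed

text \<open>The adjoint of left multiplication is right multiplication: \<omega>(bx, u) =
  \<omega>(u, bx) = \<omega>(ub, x) = \<omega>(x, ub).\<close>

lemma form_lmul:
  assumes "b \<in> vcarrier B" "x \<in> vcarrier B" "u \<in> vcarrier B"
  shows "\<omega> (lmul m b x) u = \<omega> x (m u b)"
  using assms form_sym[of "m b x" u] form_invariant[of u b x] form_sym[of "m u b" x]
  by (simp add: lmul_def mult_closed)

lemma form_rmul:
  assumes "b \<in> vcarrier B" "x \<in> vcarrier B" "u \<in> vcarrier B"
  shows "\<omega> (rmul m b x) u = \<omega> x (m b u)"
  using assms form_invariant by (simp add: rmul_def)

lemma pair_tswap:
  assumes "u \<in> vcarrier B" "v \<in> vcarrier B" and t: "t \<in> vcarrier (B \<otimes> B)"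
  shows "pair u v (tswap B B t) = pair v u t"
  using assms
  by (intro tensor_universal_unique[OF is_vspace_base_field linear_on_comp[OF pair(1) tswap(1)[OF vs vs]]
        pair(1) _ t])
    (simp_all add: pair tswap[OF vs vs])

text \<open>Dual to anti-commutativity: the flip replaces uv by vu = -uv in the pairing.\<close>

lemma tswap_comult:
  assumes "b \<in> vcarrier B"
  shows "tswap B B (D b) = - D b"
proof (rule pair_eqI)
  fix u v assume "u \<in> vcarrier B" "v \<in> vcarrier B"
  then show "pair u v (tswap B B (D b)) = pair u v (- D b)"
    using assms mult_skew[of v u]
    by (simp add: pair_tswap pair_uminus comult_in pair_comult form_uminus_right mult_closed)
qed (use assms in \<open>simp_all add: comult_in linear_onD(1)[OF tswap(1)[OF vs vs]]
  is_vspace_uminus[OF is_vspace_tensor]\<close>)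

text \<open>Paired with \<open>u \<otimes> v\<close>, each left side is \<omega>(b, -) at a triple
  product of c, u, v. By total antisymmetry this is \<omega>(b, c(uv)) = \<omega>(bc, uv) up to
  sign, and \<omega>(bc, uv) is the pairing of \<open>D (m b c)\<close>. The sign is minus for right
  multiplication and plus for left multiplication.\<close>

lemma comult_mult:
  assumes b: "b \<in> vcarrier B" and c: "c \<in> vcarrier B"
  shows "tendo B id (rmul m c) (D b) = - D (m b c)"
    and "tendo B (rmul m c) id (D b) = - D (m b c)"
    and "tendo B id (lmul m c) (D b) = D (m b c)"
    and "tendo B (lmul m c) id (D b) = D (m b c)"
proof -
  note lr = linear_on_lmul[OF c] linear_on_rmul[OF c]
  note simps = b c lr linear_on_id pair_uminus comult_in mult_closed pair_comult
    linear_onD(1)[OF tmap(1)[OF vs vs]] is_vspace_uminus[OF is_vspace_tensor] form_invariant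
  \<comment> \<open>The triple products arising from the four operators, all brought to
    c(uv).\<close>
  have skew: "\<omega> b (m u (m c v)) = - \<omega> b (m c (m u v))" "\<omega> b (m (m c u) v) = - \<omega> b (m c (m u v))"
    "\<omega> b (m u (m v c)) = \<omega> b (m c (m u v))" "\<omega> b (m (m u c) v) = \<omega> b (m c (m u v))"
    if "u \<in> vcarrier B" "v \<in> vcarrier B" for u v
  proof -
    note uv = that
    show 1: "\<omega> b (m u (m c v)) = - \<omega> b (m c (m u v))"
      using mult_left_skew[OF uv(1) c uv(2)] by (simp add: form_uminus_right b c uv mult_closed)
    show 2: "\<omega> b (m (m c u) v) = - \<omega> b (m c (m u v))"
      using mult_assoc[OF c uv] by (simp add: form_uminus_right b c uv mult_closed)
    show "\<omega> b (m u (m v c)) = \<omega> b (m c (m u v))"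
      using 1 mult_skew[OF uv(2) c]
        linear_on_neg[OF bilinear_onD(1)[OF mult uv(1)] vs vs mult_closed[OF c uv(2)]]
      by (simp add: form_uminus_right b c uv mult_closed)
    show "\<omega> b (m (m u c) v) = \<omega> b (m c (m u v))"
      using 2 mult_skew[OF uv(1) c]
      by (simp add: form_uminus_right mult_uminus_left b c uv mult_closed)
  qed
  show "tendo B id (rmul m c) (D b) = - D (m b c)"
  proof (rule pair_eqI)
    fix u v assume uv: "u \<in> vcarrier B" "v \<in> vcarrier B"
    show "pair u v (tendo B id (rmul m c) (D b)) = pair u v (- D (m b c))"
      by (subst pair_tendo[where u' = u and v' = "m c v"])
        (simp_all add: simps uv form_rmul skew)
  qed (simp_all add: simps)
  show "tendo B (rmul m c) id (D b) = - D (m b c)"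
  proof (rule pair_eqI)
    fix u v assume uv: "u \<in> vcarrier B" "v \<in> vcarrier B"
    show "pair u v (tendo B (rmul m c) id (D b)) = pair u v (- D (m b c))"
      by (subst pair_tendo[where u' = "m c u" and v' = v])
        (simp_all add: simps uv form_rmul skew)
  qed (simp_all add: simps)
  show "tendo B id (lmul m c) (D b) = D (m b c)"
  proof (rule pair_eqI)
    fix u v assume uv: "u \<in> vcarrier B" "v \<in> vcarrier B"
    show "pair u v (tendo B id (lmul m c) (D b)) = pair u v (D (m b c))"
      by (subst pair_tendo[where u' = u and v' = "m v c"])
        (simp_all add: simps uv form_lmul skew)
  qed (simp_all add: simps)
  show "tendo B (lmul m c) id (D b) = D (m b c)"
  proof (rule pair_eqI)
    fix u v assume uv: "u \<in> vcarrier B" "v \<in> vcarrier B"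
    show "pair u v (tendo B (lmul m c) id (D b)) = pair u v (D (m b c))"
      by (subst pair_tendo[where u' = "m u c" and v' = v])
        (simp_all add: simps uv form_lmul skew)
  qed (simp_all add: simps)
qed

section \<open>Threefold pairings and coassociativity up to sign\<close>

definition pair3 :: "'b \<Rightarrow> 'b \<Rightarrow> 'b \<Rightarrow> (((('b \<Rightarrow> 'b \<Rightarrow> 'k) \<Rightarrow> 'k) \<Rightarrow> 'b \<Rightarrow> 'k) \<Rightarrow> 'k) \<Rightarrow> 'k" where
  "pair3 u v w = tlift (B \<otimes> B) B base_field (\<lambda>p x. pair u v p * \<omega> x w)"

lemma pair3:
  assumes "u \<in> vcarrier B" "v \<in> vcarrier B" "w \<in> vcarrier B"
  shows "linear_on ((B \<otimes> B) \<otimes> B) base_field (pair3 u v w)"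
    and "p \<in> vcarrier (B \<otimes> B) \<Longrightarrow> x \<in> vcarrier B \<Longrightarrow>
      pair3 u v w (pure_tensor (B \<otimes> B) B p x) = pair u v p * \<omega> x w"
  unfolding pair3_def
  using tlift[OF is_vspace_base_field bilinear_on_mult_forms[OF pair(1)[OF assms(1,2)] form_left[OF assms(3)]]]
  by blast+

text \<open>\<open>tensor_eqI\<close> once more: the functionals \<open>pair u v\<close>, indexed by
  pairs, separate the left factor \<open>B \<otimes> B\<close>, and \<open>\<omega>(-, w)\<close>
  the right factor.\<close>

lemma pair3_eqI:
  assumes "t \<in> vcarrier ((B \<otimes> B) \<otimes> B)" "t' \<in> vcarrier ((B \<otimes> B) \<otimes> B)"
    and eq: "\<And>u v w. u \<in> vcarrier B \<Longrightarrow> v \<in> vcarrier B \<Longrightarrow> w \<in> vcarrier B \<Longrightarrow>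
      pair3 u v w t = pair3 u v w t'"
  shows "t = t'"
proof -
  let ?I = "vcarrier B \<times> vcarrier B" and ?\<phi> = "\<lambda>(u, v). pair u v"
  have lin: "linear_on (B \<otimes> B) base_field (?\<phi> i)" if "i \<in> ?I" for i
    using that pair(1) by auto
  have nd: "\<forall>p\<in>vcarrier (B \<otimes> B). (\<forall>i\<in>?I. ?\<phi> i p = 0) \<longrightarrow> p = 0"
  proof (intro ballI impI)
    fix p assume p: "p \<in> vcarrier (B \<otimes> B)" "\<forall>i\<in>?I. ?\<phi> i p = 0"
    show "p = 0"
    proof (rule pair_eqI[OF p(1) is_vspaceD(1)[OF is_vspace_tensor]])
      show "pair u v p = pair u v 0" if "u \<in> vcarrier B" "v \<in> vcarrier B" for u v
        using p(2) that linear_on_0[OF pair(1)[OF that] is_vspace_tensor is_vspace_base_field] by simp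
    qed
  qed
  have *: "tlift (B \<otimes> B) B base_field (\<lambda>v w. ?\<phi> i v * \<omega> w j) t =
    tlift (B \<otimes> B) B base_field (\<lambda>v w. ?\<phi> i v * \<omega> w j) t'"
    if "i \<in> ?I" "j \<in> vcarrier B" for i j
    using that eq by (auto simp: pair3_def)
  show ?thesis
    by (rule tensor_eqI[where I = ?I and J = "vcarrier B" and \<phi> = ?\<phi> and \<psi> = "\<lambda>u x. \<omega> x u",
      OF is_vspace_tensor fd lin nd form_left form_nondegenerate assms(1,2) *])
qed

text \<open>\<open>X\<close> pairs with u, v, w to \<omega>(b, (uv)w), \<open>Y\<close> to
  \<omega>(b, u(vw)), and \<open>Y\<close> with its first two slots flipped to \<omega>(b, v(uw)).
  The claims are dual to u(vw) = -(uv)w and v(uw) = -u(vw) = (uv)w.\<close>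

lemma comult_coassoc:
  assumes b: "b \<in> vcarrier B"
  defines "X \<equiv> tmap B B (B \<otimes> B) B D id (D b)"
    and "Y \<equiv> tassoc B B B (tmap B B B (B \<otimes> B) id D (D b))"
  shows "Y = - X" and "tmap (B \<otimes> B) B (B \<otimes> B) B (tswap B B) id Y = X"
proof -
  note k = is_vspace_base_field and t = is_vspace_tensor
  note TL = tmap[OF t vs linear_on_comult linear_on_id(1)]
  note TR = tmap[OF vs t linear_on_id(1) linear_on_comult]
  note A = tassoc[OF vs vs vs] and S = tswap[OF vs vs]
  note TS = tmap[OF t vs S(1) linear_on_id(1)]
  note YA = linear_on_comp[OF A(1) TR(1)]
  have X: "X \<in> vcarrier ((B \<otimes> B) \<otimes> B)"
    unfolding X_def by (rule linear_onD(1)[OF TL(1) comult_in[OF b]])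
  have Y: "Y \<in> vcarrier ((B \<otimes> B) \<otimes> B)"
    unfolding Y_def by (rule linear_onD(1)[OF YA comult_in[OF b]])
  have pX: "pair3 u v w X = \<omega> b (m (m u v) w)"
    if "u \<in> vcarrier B" "v \<in> vcarrier B" "w \<in> vcarrier B" for u v w
  proof -
    \<comment> \<open>Pairing \<open>D x\<close> with \<open>u \<otimes> v\<close> gives \<omega>(x,
      uv), so the two slots created by the inner \<open>D\<close> collapse to one slot paired with
      uv.\<close>
    have "pair3 u v w X = pair (m u v) w (D b)"
      unfolding X_def using that
      by (intro tensor_universal_unique[OF k linear_on_comp[OF pair3(1) TL(1)] pair(1) _ comult_in[OF b]])
        (simp_all add: mult_closed TL(2) pair3(2) pair(2) pair_comult comult_in)
    then show ?thesis using that b by (simp add: pair_comult mult_closed)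
  qed
  have pY: "pair3 u v w Y = \<omega> b (m u (m v w))"
    if u: "u \<in> vcarrier B" and v: "v \<in> vcarrier B" and w: "w \<in> vcarrier B" for u v w
  proof -
    \<comment> \<open>Reassociation turns the grouping (u, v), w of the pairing into u, (v, w). With
      \<open>x\<close> fixed both sides are linear in \<open>p\<close>, so pure tensors
      suffice.\<close>
    have *: "pair3 u v w (tassoc B B B (pure_tensor B (B \<otimes> B) x p)) = \<omega> x u * pair v w p"
      if x: "x \<in> vcarrier B" and p: "p \<in> vcarrier (B \<otimes> B)" for x p
    proof (rule tensor_universal_unique[OF k linear_on_comp[OF linear_on_comp[OF pair3(1)[OF u v w] A(1)]
            linear_on_pure_tensor(1)[OF vs t x]] linear_on_scale[OF k pair(1)[OF v w], simplified] _ p])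
    qed (simp add: A(2) x pair3(2) u v w pair(2) pure_tensor_in_tensor)
    have "pair3 u v w Y = pair u (m v w) (D b)"
      unfolding Y_def
      by (intro tensor_universal_unique[OF k linear_on_comp[OF pair3(1)[OF u v w] YA] pair(1) _ comult_in[OF b]])
        (simp_all add: u v w mult_closed TR(2) * pair(2) pair_comult comult_in)
    then show ?thesis using u v w b by (simp add: pair_comult mult_closed)
  qed
  have pS: "pair3 u v w (tmap (B \<otimes> B) B (B \<otimes> B) B (tswap B B) id s) = pair3 v u w s"
    if "s \<in> vcarrier ((B \<otimes> B) \<otimes> B)" "u \<in> vcarrier B" "v \<in> vcarrier B" "w \<in> vcarrier B" for u v w s
    by (rule tensor_universal_unique[OF k linear_on_comp[OF pair3(1) TS(1)] pair3(1) _ that(1)])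
      (simp_all add: that TS(2) pair3(2) pair_tswap linear_onD(1)[OF S(1)])
  have skew: "\<omega> b (m u (m v w)) = - \<omega> b (m (m u v) w)" "\<omega> b (m v (m u w)) = \<omega> b (m (m u v) w)"
    if "u \<in> vcarrier B" "v \<in> vcarrier B" "w \<in> vcarrier B" for u v w
  proof -
    show *: "\<omega> b (m u (m v w)) = - \<omega> b (m (m u v) w)"
      using mult_assoc[OF that] by (simp add: form_uminus_right b that mult_closed)
    show "\<omega> b (m v (m u w)) = \<omega> b (m (m u v) w)"
      using * mult_left_skew[OF that] by (simp add: form_uminus_right b that mult_closed)
  qed
  have neg: "pair3 u v w (- X) = - pair3 u v w X"
    if "u \<in> vcarrier B" "v \<in> vcarrier B" "w \<in> vcarrier B" for u v w
    by (rule linear_on_neg[OF pair3(1)[OF that] t k X])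
  show "Y = - X"
    by (rule pair3_eqI) (simp_all add: X Y is_vspace_uminus[OF t] neg pX pY skew)
  show "tmap (B \<otimes> B) B (B \<otimes> B) B (tswap B B) id Y = X"
    by (rule pair3_eqI) (simp_all add: X Y linear_onD(1)[OF TS(1)] pS pX pY skew(2))
qed

end


section \<open>The tensor product of a Leibniz bialgebra with a quadratic algebra\<close>

locale leibniz_quadratic_tensor = quadratic_acaa_comult B m \<omega> D
  for B :: "('k::field, 'b::ab_group_add) vspace"
    and m :: "'b \<Rightarrow> 'b \<Rightarrow> 'b" and \<omega> :: "'b \<Rightarrow> 'b \<Rightarrow> 'k" and D :: "'b \<Rightarrow> (('b \<Rightarrow> 'b \<Rightarrow> 'k) \<Rightarrow> 'k)" +
  fixes L :: "('k, 'l::ab_group_add) vspace"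
    and br :: "'l \<Rightarrow> 'l \<Rightarrow> 'l"
    and \<delta> :: "'l \<Rightarrow> (('l \<Rightarrow> 'l \<Rightarrow> 'k) \<Rightarrow> 'k)"
    and circ :: "(('l \<Rightarrow> 'b \<Rightarrow> 'k) \<Rightarrow> 'k) \<Rightarrow> (('l \<Rightarrow> 'b \<Rightarrow> 'k) \<Rightarrow> 'k) \<Rightarrow> (('l \<Rightarrow> 'b \<Rightarrow> 'k) \<Rightarrow> 'k)"
    and \<Delta> :: "(('l \<Rightarrow> 'b \<Rightarrow> 'k) \<Rightarrow> 'k) \<Rightarrow>
      (((('l \<Rightarrow> 'b \<Rightarrow> 'k) \<Rightarrow> 'k) \<Rightarrow> (('l \<Rightarrow> 'b \<Rightarrow> 'k) \<Rightarrow> 'k) \<Rightarrow> 'k) \<Rightarrow> 'k)"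
  assumes leibniz: "leibniz_bialgebra L br \<delta>"
    and circ: "bilinear_on (L \<otimes> B) (L \<otimes> B) (L \<otimes> B) circ"
    and circ_pure: "x \<in> vcarrier L \<Longrightarrow> y \<in> vcarrier L \<Longrightarrow> b \<in> vcarrier B \<Longrightarrow> c \<in> vcarrier B \<Longrightarrow>
      circ (pure_tensor L B x b) (pure_tensor L B y c) = pure_tensor L B (br x y) (m b c)"
    and \<Delta>: "linear_on (L \<otimes> B) ((L \<otimes> B) \<otimes> (L \<otimes> B)) \<Delta>"
    and \<Delta>_pure: "x \<in> vcarrier L \<Longrightarrow> b \<in> vcarrier B \<Longrightarrow>
      \<Delta> (pure_tensor L B x b) = bullet L B (\<delta> x) (D b)"
begin

abbreviation A where "A \<equiv> L \<otimes> B"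

abbreviation bul where "bul \<equiv> shuffle L L B B A A (pure_tensor L B) (pure_tensor L B)"

lemma fdL: "fd_vspace L"
  and bracket: "bilinear_on L L L br"
  and \<delta>: "linear_on L (L \<otimes> L) \<delta>"
  using leibniz unfolding leibniz_bialgebra_def leibniz_algebra_def leibniz_coalgebra_def fd_algebra_def
  by blast+

lemmas vL = fd_vspace_imp_is_vspace[OF fdL]
lemmas vT = is_vspace_tensor
lemmas bul = shuffle[OF vL vL vT vT bilinear_on_pure_tensor[OF vL vs] bilinear_on_pure_tensor[OF vL vs]]

lemma bracket_jacobi: "x \<in> vcarrier L \<Longrightarrow> y \<in> vcarrier L \<Longrightarrow> z \<in> vcarrier L \<Longrightarrow>
    br x (br y z) = br (br x y) z + br y (br x z)"
  and cobracket_jacobi: "x \<in> vcarrier L \<Longrightarrow>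
    tmap L L (L \<otimes> L) L \<delta> id (\<delta> x)
    + tmap (L \<otimes> L) L (L \<otimes> L) L (tswap L L) id (tassoc L L L (tmap L L L (L \<otimes> L) id \<delta> (\<delta> x)))
    - tassoc L L L (tmap L L L (L \<otimes> L) id \<delta> (\<delta> x)) = 0"
  and cobracket_rmul: "x \<in> vcarrier L \<Longrightarrow> y \<in> vcarrier L \<Longrightarrow>
    tswap L L (tendo L (rmul br y) id (\<delta> x)) = tendo L (rmul br x) id (\<delta> y)"
  and cobracket_bracket: "x \<in> vcarrier L \<Longrightarrow> y \<in> vcarrier L \<Longrightarrow> \<delta> (br x y) =
    (tendo L id (rmul br y) - tendo L (lmul br y + rmul br y) id) ((id + tswap L L) (\<delta> x))
    + (tendo L id (lmul br x) + tendo L (lmul br x) id) (\<delta> y)"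
  using leibniz unfolding leibniz_bialgebra_def leibniz_algebra_def leibniz_coalgebra_def
  by blast+

section \<open>Moving operators through the bullet\<close>

lemma \<Delta>_bul: "x \<in> vcarrier L \<Longrightarrow> b \<in> vcarrier B \<Longrightarrow> \<Delta> (pure_tensor L B x b) = bul (\<delta> x) (D b)"
  using \<Delta>_pure by (simp add: bullet_eq_shuffle)

lemma bul_uminus_right:
  "p \<in> vcarrier (L \<otimes> L) \<Longrightarrow> q \<in> vcarrier (B \<otimes> B) \<Longrightarrow> bul p (- q) = - bul p q"
  by (rule linear_on_neg[OF bilinear_onD(1)[OF bul(1)] vT vT])

lemma tendo_bul:
  assumes "linear_on A A F" "linear_on A A G" "linear_on L L F1" "linear_on L L G1"
    "linear_on B B F2" "linear_on B B G2"
    and "\<And>v w. v \<in> vcarrier L \<Longrightarrow> w \<in> vcarrier B \<Longrightarrow> F (pure_tensor L B v w) = pure_tensor L B (F1 v) (F2 w)"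
    and "\<And>v w. v \<in> vcarrier L \<Longrightarrow> w \<in> vcarrier B \<Longrightarrow> G (pure_tensor L B v w) = pure_tensor L B (G1 v) (G2 w)"
    and "p \<in> vcarrier (L \<otimes> L)" "q \<in> vcarrier (B \<otimes> B)"
  shows "tendo A F G (bul p q) = bul (tendo L F1 G1 p) (tendo B F2 G2 q)"
  by (intro tmap_shuffle vL vs vT bilinear_on_pure_tensor assms)

lemma tswap_bul:
  assumes "p \<in> vcarrier (L \<otimes> L)" "q \<in> vcarrier (B \<otimes> B)"
  shows "tswap A A (bul p q) = bul (tswap L L p) (tswap B B q)"
  by (rule tswap_shuffle[OF vL vL vs vs vT vT
        bilinear_on_pure_tensor[OF vL vs] bilinear_on_pure_tensor[OF vL vs] assms])

lemma bilinear_lmul: "bilinear_on A A A (lmul circ)" "bilinear_on L L L (lmul br)"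
  and bilinear_rmul: "bilinear_on A A A (rmul circ)" "bilinear_on L L L (rmul br)"
  using circ bracket bilinear_on_flip[OF circ] bilinear_on_flip[OF bracket]
  by (simp_all add: lmul_def[abs_def] rmul_def[abs_def])

lemma mul_pure:
  assumes "x \<in> vcarrier L" "b \<in> vcarrier B" "v \<in> vcarrier L" "w \<in> vcarrier B"
  shows "lmul circ (pure_tensor L B x b) (pure_tensor L B v w) = pure_tensor L B (lmul br x v) (lmul m b w)"
    and "rmul circ (pure_tensor L B x b) (pure_tensor L B v w) = pure_tensor L B (rmul br x v) (rmul m b w)"
  using assms by (simp_all add: lmul_def rmul_def circ_pure)

text \<open>On pure tensors multiplication by \<open>a\<close> acts separately on the two factors,
  so \<open>tendo_bul\<close> brings the operators of the compatibility conditions inside the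
  bullet.\<close>

lemma tendo_mul_bul:
  assumes x: "x \<in> vcarrier L" and b: "b \<in> vcarrier B"
    and p: "p \<in> vcarrier (L \<otimes> L)" and q: "q \<in> vcarrier (B \<otimes> B)"
  defines "a \<equiv> pure_tensor L B x b"
  shows "tendo A id (lmul circ a) (bul p q) = bul (tendo L id (lmul br x) p) (tendo B id (lmul m b) q)"
    and "tendo A (lmul circ a) id (bul p q) = bul (tendo L (lmul br x) id p) (tendo B (lmul m b) id q)"
    and "tendo A id (rmul circ a) (bul p q) = bul (tendo L id (rmul br x) p) (tendo B id (rmul m b) q)"
    and "tendo A (rmul circ a) id (bul p q) = bul (tendo L (rmul br x) id p) (tendo B (rmul m b) id q)"
proof -
  have a: "a \<in> vcarrier A" unfolding a_def by (rule pure_tensor_in_tensor[OF x b])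
  note lin = linear_on_id(1) bilinear_onD(1)[OF bilinear_lmul(1) a] bilinear_onD(1)[OF bilinear_rmul(1) a]
    bilinear_onD(1)[OF bilinear_lmul(2) x] bilinear_onD(1)[OF bilinear_rmul(2) x]
    linear_on_lmul[OF b] linear_on_rmul[OF b]
  note mul = mul_pure[OF x b, folded a_def]
  show "tendo A id (lmul circ a) (bul p q) = bul (tendo L id (lmul br x) p) (tendo B id (lmul m b) q)"
    by (rule tendo_bul) (simp_all add: lin mul p q)
  show "tendo A (lmul circ a) id (bul p q) = bul (tendo L (lmul br x) id p) (tendo B (lmul m b) id q)"
    by (rule tendo_bul) (simp_all add: lin mul p q)
  show "tendo A id (rmul circ a) (bul p q) = bul (tendo L id (rmul br x) p) (tendo B id (rmul m b) q)"
    by (rule tendo_bul) (simp_all add: lin mul p q)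
  show "tendo A (rmul circ a) id (bul p q) = bul (tendo L (rmul br x) id p) (tendo B (rmul m b) id q)"
    by (rule tendo_bul) (simp_all add: lin mul p q)
qed

section \<open>The anti-Leibniz bialgebra conditions\<close>

text \<open>The expression is trilinear. On pure tensors the three products in \<open>B\<close> are
  e, -e, -e with e = b(cd), which leaves the Leibniz identity of \<open>L\<close> tensored with
  e.\<close>

lemma anti_leibniz_identity:
  assumes "a1 \<in> vcarrier A" "a2 \<in> vcarrier A" "a3 \<in> vcarrier A"
  shows "circ a1 (circ a2 a3) + circ (circ a1 a2) a3 + circ a2 (circ a1 a3) = 0"
proof -
  note cl = bilinear_onD(3)[OF circ]
  have left: "linear_on X A (\<lambda>x. circ (f x) c)" if "linear_on X A f" "c \<in> vcarrier A"
    for X :: "('k, ('l \<Rightarrow> 'b \<Rightarrow> 'k) \<Rightarrow> 'k) vspace" and f c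
    by (rule linear_on_comp[OF bilinear_onD(2)[OF circ that(2)] that(1)])
  have right: "linear_on X A (\<lambda>x. circ c (f x))" if "linear_on X A f" "c \<in> vcarrier A"
    for X :: "('k, ('l \<Rightarrow> 'b \<Rightarrow> 'k) \<Rightarrow> 'k) vspace" and f c
    by (rule linear_on_comp[OF bilinear_onD(1)[OF circ that(2)] that(1)])
  note lin = linear_on_add[OF vT] left right linear_on_id(2)
  let ?J = "\<lambda>a1 a2 a3. circ a1 (circ a2 a3) + circ (circ a1 a2) a3 + circ a2 (circ a1 a3)"
  have 1: "linear_on A A (\<lambda>a. ?J a a2 a3)" if "a2 \<in> vcarrier A" "a3 \<in> vcarrier A" for a2 a3
    using that by (intro lin cl)
  have 2: "linear_on A A (\<lambda>a. ?J a1 a a3)" if "a1 \<in> vcarrier A" "a3 \<in> vcarrier A" for a1 a3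
    using that by (intro lin cl)
  have 3: "linear_on A A (\<lambda>a. ?J a1 a2 a)" if "a1 \<in> vcarrier A" "a2 \<in> vcarrier A" for a1 a2
    using that by (intro lin cl)
  note z = linear_on_zero[OF vT] and pure = pure_tensor_in_tensor
  have main: "?J (pure_tensor L B x b) (pure_tensor L B y c) (pure_tensor L B z d) = 0"
    if x: "x \<in> vcarrier L" and y: "y \<in> vcarrier L" and z: "z \<in> vcarrier L"
      and b: "b \<in> vcarrier B" and c: "c \<in> vcarrier B" and d: "d \<in> vcarrier B" for x y z b c d
  proof -
    note brcl = bilinear_onD(3)[OF bracket]
    let ?e = "m b (m c d)"
    have e: "?e \<in> vcarrier B" using b c d by (simp add: mult_closed)
    note P = linear_on_pure_tensor(2)[OF vL vs e]
    have "m (m b c) d = - ?e" "m c (m b d) = - ?e"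
      using mult_assoc[OF b c d] mult_left_skew[OF c b d] by simp_all
    then have "?J (pure_tensor L B x b) (pure_tensor L B y c) (pure_tensor L B z d) =
      pure_tensor L B (br x (br y z)) ?e + pure_tensor L B (br (br x y) z) (- ?e)
        + pure_tensor L B (br y (br x z)) (- ?e)"
      by (simp add: x y z b c d circ_pure brcl mult_closed)
    also have "\<dots> = pure_tensor L B (br x (br y z)) ?e - pure_tensor L B (br (br x y) z) ?e
        - pure_tensor L B (br y (br x z)) ?e"
      by (simp add: x y z brcl e linear_on_neg[OF linear_on_pure_tensor(1)[OF vL vs] vs vT])
    also have "\<dots> = 0"
      by (simp only: bracket_jacobi[OF x y z] linear_onD(2)[OF P] brcl x y z) simp
    finally show ?thesis .
  qed
  \<comment> \<open>The arguments are freed one at a time, from the last to the first.\<close>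
  have s1: "?J (pure_tensor L B x b) (pure_tensor L B y c) a = 0"
    if "x \<in> vcarrier L" "y \<in> vcarrier L" "b \<in> vcarrier B" "c \<in> vcarrier B" "a \<in> vcarrier A" for x y b c a
    by (rule tensor_universal_unique[OF vT 3 z _ that(5)]) (use that pure main in auto)
  have s2: "?J (pure_tensor L B x b) a' a = 0"
    if "x \<in> vcarrier L" "b \<in> vcarrier B" "a' \<in> vcarrier A" "a \<in> vcarrier A" for x b a' a
    by (rule tensor_universal_unique[OF vT 2 z _ that(3)]) (use that pure s1 in auto)
  show ?thesis
    by (rule tensor_universal_unique[OF vT 1 z _ assms(1)]) (use assms s2 in auto)
qed

text \<open>On \<open>pure_tensor L B x b\<close> each term is a threefold bullet. By
  \<open>comult_coassoc\<close> the factors from \<open>B\<close> are \<open>?X\<close>,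
  \<open>-?X\<close>, \<open>?X\<close>, so the sum is the bullet of \<open>?P - ?R + ?S\<close>,
  which is 0 by the coalgebra identity of \<open>L\<close>, with \<open>?X\<close>.\<close>

lemma anti_leibniz_coidentity:
  assumes a: "a \<in> vcarrier A"
  shows "tmap A A (A \<otimes> A) A \<Delta> id (\<Delta> a)
    + tassoc A A A (tmap A A A (A \<otimes> A) id \<Delta> (\<Delta> a))
    + tmap (A \<otimes> A) A (A \<otimes> A) A (tswap A A) id
        (tassoc A A A (tmap A A A (A \<otimes> A) id \<Delta> (\<Delta> a))) = 0"
proof -
  note idA = linear_on_id(1)
  note pt = bilinear_on_pure_tensor[OF vL vs]
  note TL = tmap[OF vT vT \<Delta> idA] and TR = tmap[OF vT vT idA \<Delta>]
  note As = tassoc[OF vT[of L B] vT[of L B] vT[of L B]] and Sw = tswap[OF vT[of L B] vT[of L B]]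
  note TS = tmap[OF vT vT Sw(1) idA]
  note lTR = linear_on_comp[OF As(1) linear_on_comp[OF TR(1) \<Delta>]]
  note lin = linear_on_add[OF vT linear_on_add[OF vT linear_on_comp[OF TL(1) \<Delta>] lTR]
    linear_on_comp[OF TS(1) lTR]]
  \<comment> \<open>The left-nested threefold bullet, with \<open>bul\<close> on the first two
    factors.\<close>
  let ?\<Phi> = "shuffle (L \<otimes> L) L (B \<otimes> B) B (A \<otimes> A) A bul (pure_tensor L B)"
  note \<Phi> = shuffle[OF vT vL vT vT bul(1) pt]
  show ?thesis
  proof (rule tensor_universal_unique[OF vT lin linear_on_zero[OF vT] _ a])
    fix x b assume x: "x \<in> vcarrier L" and b: "b \<in> vcarrier B"
    note p = linear_onD(1)[OF \<delta> x] and q = comult_in[OF b]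
    let ?P = "tmap L L (L \<otimes> L) L \<delta> id (\<delta> x)" and ?R = "tassoc L L L (tmap L L L (L \<otimes> L) id \<delta> (\<delta> x))"
    let ?S = "tmap (L \<otimes> L) L (L \<otimes> L) L (tswap L L) id ?R"
    let ?X = "tmap B B (B \<otimes> B) B D id (D b)" and ?Y = "tassoc B B B (tmap B B B (B \<otimes> B) id D (D b))"
    note lTRL = linear_onD(1)[OF tmap(1)[OF vL vT linear_on_id(1) \<delta>] p]
      and lTRB = linear_onD(1)[OF tmap(1)[OF vs vT linear_on_id(1) linear_on_comult] q]
    have P: "?P \<in> vcarrier ((L \<otimes> L) \<otimes> L)" by (rule linear_onD(1)[OF tmap(1)[OF vT vL \<delta> linear_on_id(1)] p])
    have R: "?R \<in> vcarrier ((L \<otimes> L) \<otimes> L)" by (rule linear_onD(1)[OF tassoc(1)[OF vL vL vL] lTRL])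
    have S: "?S \<in> vcarrier ((L \<otimes> L) \<otimes> L)"
      by (rule linear_onD(1)[OF tmap(1)[OF vT vL tswap(1)[OF vL vL] linear_on_id(1)] R])
    have X: "?X \<in> vcarrier ((B \<otimes> B) \<otimes> B)"
      by (rule linear_onD(1)[OF tmap(1)[OF vT vs linear_on_comult linear_on_id(1)] q])
    have Y: "?Y \<in> vcarrier ((B \<otimes> B) \<otimes> B)" by (rule linear_onD(1)[OF tassoc(1)[OF vs vs vs] lTRB])
    have 1: "tmap A A (A \<otimes> A) A \<Delta> id (bul (\<delta> x) (D b)) = ?\<Phi> ?P ?X"
      by (intro tmap_shuffle vL vs vT pt bul(1) \<Delta> idA \<delta> linear_on_id(1) linear_on_comult p q) (simp_all add: \<Delta>_bul)
    \<comment> \<open>Comultiplying the second factor gives the right-nested bullet;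
      \<open>tassoc_shuffle\<close> then turns it into \<open>?\<Phi>\<close>.\<close>
    have "tmap A A A (A \<otimes> A) id \<Delta> (bul (\<delta> x) (D b)) =
      shuffle L (L \<otimes> L) B (B \<otimes> B) A (A \<otimes> A) (pure_tensor L B) bul
        (tmap L L L (L \<otimes> L) id \<delta> (\<delta> x)) (tmap B B B (B \<otimes> B) id D (D b))"
      by (intro tmap_shuffle vL vs vT pt bul(1) \<Delta> idA \<delta> linear_on_id(1) linear_on_comult p q) (simp_all add: \<Delta>_bul)
    then have 2: "tassoc A A A (tmap A A A (A \<otimes> A) id \<Delta> (bul (\<delta> x) (D b))) = ?\<Phi> ?R ?Y"
      using tassoc_shuffle[OF vL vL vL vs vs vs vT vT vT pt pt pt lTRL lTRB] by (simp only:)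
    have 3: "tmap (A \<otimes> A) A (A \<otimes> A) A (tswap A A) id (?\<Phi> ?R ?Y) =
      ?\<Phi> ?S (tmap (B \<otimes> B) B (B \<otimes> B) B (tswap B B) id ?Y)"
      by (intro tmap_shuffle vL vs vT pt bul(1) Sw(1) idA tswap(1) linear_on_id(1) R Y)
        (simp_all add: tswap_bul)
    note lin\<Phi> = bilinear_onD(2)[OF \<Phi>(1) X]
    have neg: "?\<Phi> ?R (- ?X) = - ?\<Phi> ?R ?X"
      by (rule linear_on_neg[OF bilinear_onD(1)[OF \<Phi>(1) R] vT vT X])
    have "?\<Phi> ?P ?X - ?\<Phi> ?R ?X + ?\<Phi> ?S ?X = ?\<Phi> (?P + ?S - ?R) ?X"
      using linear_on_minus[OF lin\<Phi> vT vT is_vspaceD(2)[OF vT P S] R] linear_onD(2)[OF lin\<Phi> P S]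
      by (simp only: algebra_simps)
    also have "\<dots> = 0"
      unfolding cobracket_jacobi[OF x] by (rule linear_on_0[OF lin\<Phi> vT vT])
    finally have "?\<Phi> ?P ?X - ?\<Phi> ?R ?X + ?\<Phi> ?S ?X = 0" .
    then show "tmap A A (A \<otimes> A) A \<Delta> id (\<Delta> (pure_tensor L B x b))
        + tassoc A A A (tmap A A A (A \<otimes> A) id \<Delta> (\<Delta> (pure_tensor L B x b)))
        + tmap (A \<otimes> A) A (A \<otimes> A) A (tswap A A) id
            (tassoc A A A (tmap A A A (A \<otimes> A) id \<Delta> (\<Delta> (pure_tensor L B x b)))) = 0"
      \<comment> \<open>The flipped term is rewritten first: replacing \<open>?Y\<close> by
        \<open>- ?X\<close> inside it would destroy the left side of
        \<open>comult_coassoc(2)\<close>.\<close>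
      unfolding \<Delta>_bul[OF x b] 1 2 3 comult_coassoc(2)[OF b] unfolding comult_coassoc(1)[OF b] neg
      by (simp only: diff_conv_add_uminus)
  qed
qed

text \<open>Since \<open>D b\<close> is antisymmetric, \<open>id - \<tau>\<close> on a bullet
  becomes \<open>id + \<tau>\<close> on the factor from \<open>L\<close>. By
  \<open>comult_mult\<close> every factor from \<open>B\<close> is \<open>D (m b c)\<close> up to
  sign, and the signs leave exactly the Leibniz compatibility condition of \<open>L\<close>.\<close>

lemma comult_circ:
  assumes a1: "a1 \<in> vcarrier A" and a2: "a2 \<in> vcarrier A"
  shows "\<Delta> (circ a1 a2)
    + (tendo A id (rmul circ a2) - tendo A (rmul circ a2) id + tendo A (lmul circ a2) id)
        ((id - tswap A A) (\<Delta> a1))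
    + (tendo A id (lmul circ a1) + tendo A (lmul circ a1) id) (\<Delta> a2) = 0"
proof -
  let ?T = "A \<otimes> A" and ?S = "\<lambda>a. \<Delta> a - tswap A A (\<Delta> a)"
  note Sw = tswap[OF vT[of L B] vT[of L B]]
  have S: "linear_on A ?T ?S"
    by (rule linear_on_diff[OF vT \<Delta> linear_on_comp[OF Sw(1) \<Delta>]])
  note left = bilinear_on_tmap_left[OF vT vT vT _ linear_on_id(1)]
    and right = bilinear_on_tmap_right[OF vT vT vT linear_on_id(1)]
  \<comment> \<open>The claim with its pointwise sums of operators written out, so that bilinearity
    can be read off term by term.\<close>
  let ?F = "\<lambda>a1 a2. \<Delta> (circ a1 a2)
    + (tendo A id (rmul circ a2) (?S a1) - tendo A (rmul circ a2) id (?S a1)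
      + tendo A (lmul circ a2) id (?S a1))
    + (tendo A id (lmul circ a1) (\<Delta> a2) + tendo A (lmul circ a1) id (\<Delta> a2))"
  have F: "bilinear_on A A ?T ?F"
    by (intro bilinear_on_add bilinear_on_diff vT linear_on_bilinear_on[OF \<Delta> circ]
        bilinear_on_flip[OF right[OF bilinear_rmul(1) S]] bilinear_on_flip[OF left[OF bilinear_rmul(1) S]]
        bilinear_on_flip[OF left[OF bilinear_lmul(1) S]] right[OF bilinear_lmul(1) \<Delta>]
        left[OF bilinear_lmul(1) \<Delta>])
  have "?F a1 a2 = 0"
  proof (rule bilinear_unique[OF vT F bilinear_on_zero[OF vT] _ a1 a2])
    fix x b y c
    assume x: "x \<in> vcarrier L" and b: "b \<in> vcarrier B" and y: "y \<in> vcarrier L" and c: "c \<in> vcarrier B"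
    let ?p = "\<delta> x" and ?q = "D b" and ?p' = "\<delta> y" and ?q' = "D c" and ?e = "D (m b c)"
    note p = linear_onD(1)[OF \<delta> x] and q = comult_in[OF b]
      and p' = linear_onD(1)[OF \<delta> y] and q' = comult_in[OF c]
    have e: "?e \<in> vcarrier (B \<otimes> B)" by (rule comult_in[OF mult_closed[OF b c]])
    have sp: "tswap L L ?p \<in> vcarrier (L \<otimes> L)" by (rule linear_onD(1)[OF tswap(1)[OF vL vL] p])
    let ?P = "?p + tswap L L ?p"
    have P: "?P \<in> vcarrier (L \<otimes> L)" by (rule is_vspaceD(2)[OF vT p sp])
    have SP: "?S (pure_tensor L B x b) = bul ?P ?q"
      using linear_onD(2)[OF bilinear_onD(2)[OF bul(1) q] p sp]
      by (simp add: \<Delta>_bul[OF x b] tswap_bul[OF p q] tswap_comult[OF b] bul_uminus_right[OF sp q])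
    \<comment> \<open>Multiplication by \<open>pure_tensor L B x b\<close> acts on
      \<open>D c\<close> and so produces \<open>D (m c b)\<close>, with the factors in the opposite
      order; this is the sign of the last two terms.\<close>
    have swap: "D (m c b) = - ?e"
      using mult_skew[OF c b] linear_on_neg[OF linear_on_comult vs vT mult_closed[OF b c]] by simp
    note ly = bilinear_onD(1)[OF bilinear_lmul(2) y] and ry = bilinear_onD(1)[OF bilinear_rmul(2) y]
      and lx = bilinear_onD(1)[OF bilinear_lmul(2) x] and i = linear_on_id(1)
    let ?t1 = "tendo L id (rmul br y) ?P" and ?t2 = "tendo L (rmul br y) id ?P"
      and ?t3 = "tendo L (lmul br y) id ?P" and ?t4 = "tendo L id (lmul br x) ?p'"
      and ?t5 = "tendo L (lmul br x) id ?p'"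
    have t1: "?t1 \<in> vcarrier (L \<otimes> L)" and t2: "?t2 \<in> vcarrier (L \<otimes> L)" and t3: "?t3 \<in> vcarrier (L \<otimes> L)"
      and t4: "?t4 \<in> vcarrier (L \<otimes> L)" and t5: "?t5 \<in> vcarrier (L \<otimes> L)"
      using linear_onD(1)[OF tmap(1)[OF vL vL i ry] P] linear_onD(1)[OF tmap(1)[OF vL vL ry i] P]
        linear_onD(1)[OF tmap(1)[OF vL vL ly i] P] linear_onD(1)[OF tmap(1)[OF vL vL i lx] p']
        linear_onD(1)[OF tmap(1)[OF vL vL lx i] p'] by blast+
    have \<delta>xy: "\<delta> (br x y) = ?t1 - (?t3 + ?t2) + (?t4 + ?t5)"
      using cobracket_bracket[OF x y] tmap_add_left[OF vL vL ly ry i P] by simp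
    have "bul (\<delta> (br x y)) ?e = bul ?t1 ?e - (bul ?t3 ?e + bul ?t2 ?e) + (bul ?t4 ?e + bul ?t5 ?e)"
      by (simp only: \<delta>xy linear_onD(2)[OF bilinear_onD(2)[OF bul(1) e]]
          linear_on_minus[OF bilinear_onD(2)[OF bul(1) e] vT vT]
          is_vspaceD(2)[OF vT] is_vspace_diff[OF vT] t1 t2 t3 t4 t5)
    moreover have "?F (pure_tensor L B x b) (pure_tensor L B y c) =
      bul (\<delta> (br x y)) ?e + (- bul ?t1 ?e - - bul ?t2 ?e + bul ?t3 ?e) + (- bul ?t4 ?e + - bul ?t5 ?e)"
      unfolding SP
      unfolding \<Delta>_bul[OF y c] tendo_mul_bul[OF y c P q] tendo_mul_bul[OF x b p' q'] circ_pure[OF x y b c]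
        \<Delta>_bul[OF bilinear_onD(3)[OF bracket x y] mult_closed[OF b c]] comult_mult[OF b c]
        comult_mult[OF c b] swap bul_uminus_right[OF t1 e] bul_uminus_right[OF t2 e]
        bul_uminus_right[OF t4 e] bul_uminus_right[OF t5 e]
      by (rule refl)
    ultimately show "?F (pure_tensor L B x b) (pure_tensor L B y c) = 0" by (simp only:) simp
  qed
  then show ?thesis by simp
qed

text \<open>On pure tensors the first term has the factor \<open>- D (m c b) = D (m b c)\<close>
  from \<open>B\<close>, and the second has \<open>\<tau>(- D (m b c)) = D (m b c)\<close>. The
  difference vanishes by the corresponding symmetry condition \<open>cobracket_rmul\<close> of
  \<open>L\<close>.\<close>

lemma comult_rmul:
  assumes a1: "a1 \<in> vcarrier A" and a2: "a2 \<in> vcarrier A"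
  shows "tendo A (rmul circ a1) id (\<Delta> a2) - tswap A A (tendo A (rmul circ a2) id (\<Delta> a1)) = 0"
proof -
  let ?F = "\<lambda>a1 a2. tendo A (rmul circ a1) id (\<Delta> a2) - tswap A A (tendo A (rmul circ a2) id (\<Delta> a1))"
  note Sw = tswap[OF vT[of L B] vT[of L B]]
  note left = bilinear_on_tmap_left[OF vT vT vT bilinear_rmul(1) linear_on_id(1) \<Delta>]
  have F: "bilinear_on A A (A \<otimes> A) ?F"
    by (rule bilinear_on_diff[OF vT left linear_on_bilinear_on[OF Sw(1) bilinear_on_flip[OF left]]])
  show ?thesis
  proof (rule bilinear_unique[OF vT F bilinear_on_zero[OF vT] _ a1 a2])
    fix x b y c
    assume x: "x \<in> vcarrier L" and b: "b \<in> vcarrier B" and y: "y \<in> vcarrier L" and c: "c \<in> vcarrier B"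
    note p = linear_onD(1)[OF \<delta> x] and q = comult_in[OF b]
      and p' = linear_onD(1)[OF \<delta> y] and q' = comult_in[OF c]
    have e: "D (m b c) \<in> vcarrier (B \<otimes> B)" by (rule comult_in[OF mult_closed[OF b c]])
    have swap: "D (m c b) = - D (m b c)"
      using mult_skew[OF c b] linear_on_neg[OF linear_on_comult vs vT mult_closed[OF b c]] by simp
    have "tendo L (rmul br y) id (\<delta> x) \<in> vcarrier (L \<otimes> L)"
      by (rule linear_onD(1)[OF tmap(1)[OF vL vL bilinear_onD(1)[OF bilinear_rmul(2) y] linear_on_id(1)] p])
    moreover have "tswap B B (- D (m b c)) = D (m b c)"
      using linear_on_neg[OF tswap(1)[OF vs vs] vT vT e] tswap_comult[OF mult_closed[OF b c]] by simp
    ultimately show "?F (pure_tensor L B x b) (pure_tensor L B y c) = 0"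
      unfolding \<Delta>_bul[OF x b] \<Delta>_bul[OF y c] tendo_mul_bul(4)[OF y c p q] tendo_mul_bul(4)[OF x b p' q']
        comult_mult(2)[OF b c] comult_mult(2)[OF c b] swap
      using is_vspace_uminus[OF vT e] by (simp add: tswap_bul cobracket_rmul[OF x y])
  qed
qed

end

theorem theorem3p37:
  fixes L :: "('k::field_char_0, 'l::ab_group_add) vspace"
    and B :: "('k, 'b::ab_group_add) vspace"
    and A :: "('k, ('l \<Rightarrow> 'b \<Rightarrow> 'k) \<Rightarrow> 'k) vspace"
    and br :: "'l \<Rightarrow> 'l \<Rightarrow> 'l"
    and \<delta> :: "'l \<Rightarrow> (('l \<Rightarrow> 'l \<Rightarrow> 'k) \<Rightarrow> 'k)"
    and m :: "'b \<Rightarrow> 'b \<Rightarrow> 'b"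
    and \<omega> :: "'b \<Rightarrow> 'b \<Rightarrow> 'k"
    and \<Delta>\<^sub>\<omega> :: "'b \<Rightarrow> (('b \<Rightarrow> 'b \<Rightarrow> 'k) \<Rightarrow> 'k)"
    and circ :: "(('l \<Rightarrow> 'b \<Rightarrow> 'k) \<Rightarrow> 'k) \<Rightarrow> (('l \<Rightarrow> 'b \<Rightarrow> 'k) \<Rightarrow> 'k) \<Rightarrow> (('l \<Rightarrow> 'b \<Rightarrow> 'k) \<Rightarrow> 'k)"
    and \<Delta> :: "(('l \<Rightarrow> 'b \<Rightarrow> 'k) \<Rightarrow> 'k) \<Rightarrow>
      (((('l \<Rightarrow> 'b \<Rightarrow> 'k) \<Rightarrow> 'k) \<Rightarrow> (('l \<Rightarrow> 'b \<Rightarrow> 'k) \<Rightarrow> 'k) \<Rightarrow> 'k) \<Rightarrow> 'k)"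
  assumes "leibniz_bialgebra L br \<delta>"
    and "quadratic_acaa_algebra B m \<omega>"
    and "A = L \<otimes> B"
    and "bilinear_on A A A circ"
    and "\<forall>x1\<in>vcarrier L. \<forall>x2\<in>vcarrier L. \<forall>b1\<in>vcarrier B. \<forall>b2\<in>vcarrier B.
      circ (pure_tensor L B x1 b1) (pure_tensor L B x2 b2) = pure_tensor L B (br x1 x2) (m b1 b2)"
    and "\<forall>b\<in>vcarrier B. \<Delta>\<^sub>\<omega> b \<in> vcarrier (B \<otimes> B)"
    and "\<forall>b1\<in>vcarrier B. \<forall>b2\<in>vcarrier B. \<forall>b3\<in>vcarrier B.
      tensor_form B \<omega> (\<Delta>\<^sub>\<omega> b1) (pure_tensor B B b2 b3) = \<omega> b1 (m b2 b3)"
    and "linear_on A (A \<otimes> A) \<Delta>"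
    and "\<forall>x\<in>vcarrier L. \<forall>b\<in>vcarrier B. \<Delta> (pure_tensor L B x b) = bullet L B (\<delta> x) (\<Delta>\<^sub>\<omega> b)"
  shows "anti_leibniz_bialgebra A circ \<Delta>"
proof -
  interpret leibniz_quadratic_tensor B m \<omega> \<Delta>\<^sub>\<omega> L br \<delta> circ \<Delta>
    using assms(1,2,4-) unfolding assms(3) by unfold_locales blast+
  show ?thesis
    unfolding assms(3) anti_leibniz_bialgebra_def anti_leibniz_algebra_def fd_algebra_def
    using fd_vspace_tensor[OF fdL fd] circ anti_leibniz_identity \<Delta> anti_leibniz_coidentity
      comult_circ comult_rmul
    by blast
qed

end
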